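(* Let $X$ be a perfect, compact plane set such that $\mathbb{C}\setminus X$ is connected and $X$ has empty interior. Suppose that $\mathcal{F}$ is a useful set of paths in $X$ with the following properties: $\overline{\mathcal{F}(X)}=X$, the set of lengths of paths in $\mathcal{F}$ is bounded above, and every pair of distinct points of $X$ which are in the same component of $X$ can be joined by a path in $\mathcal{F}$. Set $D=\mathcal{D}^1_{\mathcal{F}}(X)$. Then $D=D_R=D_P$ and $\mathcal{D}^1_{\mathcal{F}}(X)$ is the completion of $D^1(X)$.
   Context: Perfect means non-empty without isolated points. A function $f:X\to\mathbb{C}$ is complex-differentiable at $a\in X$ if $f'(a)=\lim_{z\to a,\,z\in X\setminus\{a\}}\frac{f(z)-f(a)}{z-a}$ exists. $D^1(X)$ is the space of continuously complex-differentiable functions on $X$, with norm $\|f\|=\|f\|_\infty+\|f'\|_\infty$ (supremum norms on $X$). A path in $X$ is a continuous map $\gamma:[a,b]\to X$ with $a<b$ real; its endpoints are $\gamma^-=\gamma(a)$ and $\gamma^+=\gamma(b)$. A Jordan arc is an injective path. A set $\mathcal{F}$ of paths in $X$ is useful if every path in $\mathcal{F}$ is a rectifiable Jordan arc and, whenever $\gamma\in\mathcal{F}$ is defined on $[a,b]$ and $[c,d]\subseteq[a,b]$ with $c<d$, the restriction of $\gamma$ to $[c,d]$ is in $\mathcal{F}$. Write $\mathcal{F}(X)=\bigcup_{\gamma\in\mathcal{F}}\mathrm{Image}(\gamma)$. For $f\in C(X)$ (continuous complex-valued functions on $X$), a function $g\in C(X)$ is an $\mathcal{F}$-derivative of $f$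 if $\int_\gamma g(z)\,dz=f(\gamma^+)-f(\gamma^-)$ for every $\gamma\in\mathcal{F}$. $\mathcal{D}^1_{\mathcal{F}}(X)$ is the set of $f\in C(X)$ which have an $\mathcal{F}$-derivative in $C(X)$. When $\overline{\mathcal{F}(X)}=X$ the $\mathcal{F}$-derivative $g$ of $f$ is unique, $\mathcal{D}^1_{\mathcal{F}}(X)$ is a Banach algebra with norm $\|f\|=\|f\|_\infty+\|g\|_\infty$, and $D^1(X)$ is contained isometrically in it; "$\mathcal{D}^1_{\mathcal{F}}(X)$ is the completion of $D^1(X)$" means that $D^1(X)$ is dense in $\mathcal{D}^1_{\mathcal{F}}(X)$. $D_R$ is the closure in $D$ of the set of (restrictions to $X$ of) rational functions with poles off $X$, and $D_P$ is the closure in $D$ of the set of (restrictions to $X$ of) polynomial functions in $z$. *)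

theory Defs
  imports "HOL-Analysis.Analysis" "HOL-Computational_Algebra.Polynomial"
begin

definition perfect_set :: "complex set \<Rightarrow> bool" where
  "perfect_set X \<longleftrightarrow> X \<noteq> {} \<and> (\<forall>x\<in>X. \<not> x isolated_in X)"

section \<open>Paths, rectifiability and path integrals\<close>

text \<open>
  The triple \<open>(a, b, \<gamma>)\<close> stands for the path \<open>\<gamma> : [a,b] \<rightarrow> \<complex>\<close>. Paths are required to be
  extensional on \<open>[a,b]\<close>, so that triples correspond one-to-one to paths, and the restriction
  of a path to \<open>[c,d]\<close> is \<open>(c, d, restrict \<gamma> {c..d})\<close>.
\<close>
type_synonym cpath = "real \<times> real \<times> (real \<Rightarrow> complex)"

definition path_in :: "complex set \<Rightarrow> cpath \<Rightarrow> bool" where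
  "path_in X = (\<lambda>(a, b, \<gamma>). a < b \<and> \<gamma> \<in> extensional {a..b} \<and>
     continuous_on {a..b} \<gamma> \<and> \<gamma> ` {a..b} \<subseteq> X)"

definition jordan_arc_in :: "complex set \<Rightarrow> cpath \<Rightarrow> bool" where
  "jordan_arc_in X = (\<lambda>(a, b, \<gamma>). path_in X (a, b, \<gamma>) \<and> inj_on \<gamma> {a..b})"

definition variation_sums :: "cpath \<Rightarrow> real set" where
  "variation_sums = (\<lambda>(a, b, \<gamma>).
     {(\<Sum>k\<in>d. cmod (\<gamma> (Sup k) - \<gamma> (Inf k))) | d. d division_of {a..b}})"

definition rectifiable :: "cpath \<Rightarrow> bool" where
  "rectifiable p \<longleftrightarrow> bdd_above (variation_sums p)"

definition cpath_length :: "cpath \<Rightarrow> real" where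
  "cpath_length p = Sup (variation_sums p)"

text \<open>
  The integral \<open>\<integral>\<^sub>\<gamma> g(z) dz\<close> along a path that is merely rectifiable is the Riemann--Stieltjes
  integral of \<open>g \<circ> \<gamma>\<close> against \<open>\<gamma>\<close>, i.e. the limit of the sums
  \<open>\<Sum> g(\<gamma>(x\<^sub>i)) (\<gamma>(t\<^sub>i\<^sub>+\<^sub>1) - \<gamma>(t\<^sub>i))\<close> as the mesh tends to 0. The library's contour integral is not
  usable here: it integrates \<open>g(\<gamma>(t)) \<gamma>'(t)\<close>, which for a path of bounded variation that is not
  absolutely continuous is a different quantity.
\<close>
definition has_path_integral :: "(complex \<Rightarrow> complex) \<Rightarrow> complex \<Rightarrow> cpath \<Rightarrow> bool" where
  "has_path_integral g I = (\<lambda>(a, b, \<gamma>).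
     \<forall>e>0. \<exists>\<delta>>0. \<forall>p. p tagged_division_of {a..b} \<and> (\<forall>(x, k)\<in>p. Sup k - Inf k < \<delta>) \<longrightarrow>
       cmod ((\<Sum>(x, k)\<in>p. g (\<gamma> x) * (\<gamma> (Sup k) - \<gamma> (Inf k))) - I) < e)"

definition useful :: "complex set \<Rightarrow> cpath set \<Rightarrow> bool" where
  "useful X F \<longleftrightarrow>
     (\<forall>p\<in>F. jordan_arc_in X p \<and> rectifiable p) \<and>
     (\<forall>(a, b, \<gamma>)\<in>F. \<forall>c d. c < d \<and> {c..d} \<subseteq> {a..b} \<longrightarrow> (c, d, restrict \<gamma> {c..d}) \<in> F)"

definition paths_image :: "cpath set \<Rightarrow> complex set" where
  "paths_image F = (\<Union>(a, b, \<gamma>)\<in>F. \<gamma> ` {a..b})"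

text \<open>One of \<open>z\<close>, \<open>w\<close> is the initial point and the other one the final point; the orientation
  is left open.\<close>
definition joined_by :: "cpath \<Rightarrow> complex \<Rightarrow> complex \<Rightarrow> bool" where
  "joined_by = (\<lambda>(a, b, \<gamma>) z w. {\<gamma> a, \<gamma> b} = {z, w})"

section \<open>The function spaces\<close>

text \<open>Functions on \<open>X\<close> are total functions that are extensional on \<open>X\<close>, so that equality of
  functions is equality on \<open>X\<close>.\<close>
definition C_space :: "complex set \<Rightarrow> (complex \<Rightarrow> complex) set" where
  "C_space X = {f \<in> extensional X. continuous_on X f}"

text \<open>If \<open>X\<close> has no isolated points, then the function \<open>f'\<close> below is the pointwise limit of
  difference quotients over \<open>X\<close>, and is unique.\<close>
definition D1_space :: "complex set \<Rightarrow> (complex \<Rightarrow> complex) set" where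
  "D1_space X = {f \<in> extensional X. \<exists>f'\<in>C_space X.
     \<forall>a\<in>X. (f has_field_derivative f' a) (at a within X)}"

definition F_derivative ::
  "complex set \<Rightarrow> cpath set \<Rightarrow> (complex \<Rightarrow> complex) \<Rightarrow> (complex \<Rightarrow> complex) \<Rightarrow> bool" where
  "F_derivative X F f g \<longleftrightarrow> f \<in> C_space X \<and> g \<in> C_space X \<and>
     (\<forall>(a, b, \<gamma>)\<in>F. has_path_integral g (f (\<gamma> b) - f (\<gamma> a)) (a, b, \<gamma>))"

definition DF_space :: "complex set \<Rightarrow> cpath set \<Rightarrow> (complex \<Rightarrow> complex) set" where
  "DF_space X F = {f \<in> C_space X. \<exists>g. F_derivative X F f g}"

definition sup_norm :: "complex set \<Rightarrow> (complex \<Rightarrow> complex) \<Rightarrow> real" where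
  "sup_norm X f = (SUP z\<in>X. cmod (f z))"

text \<open>Meaningful on \<open>DF_space X F\<close> when \<open>paths_image F\<close> is dense in \<open>X\<close>, since the
  \<open>F\<close>-derivative is unique in that case.\<close>
definition DF_norm :: "complex set \<Rightarrow> cpath set \<Rightarrow> (complex \<Rightarrow> complex) \<Rightarrow> real" where
  "DF_norm X F f = sup_norm X f + sup_norm X (THE g. F_derivative X F f g)"

definition DF_closure ::
  "complex set \<Rightarrow> cpath set \<Rightarrow> (complex \<Rightarrow> complex) set \<Rightarrow> (complex \<Rightarrow> complex) set" where
  "DF_closure X F S = {f \<in> DF_space X F.
     \<forall>e>0. \<exists>h \<in> S \<inter> DF_space X F. DF_norm X F (\<lambda>z\<in>X. f z - h z) < e}"

definition rational_functions :: "complex set \<Rightarrow> (complex \<Rightarrow> complex) set" where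
  "rational_functions X =
     {(\<lambda>z\<in>X. poly p z / poly q z) | p q. \<forall>z\<in>X. poly q z \<noteq> 0}"

definition polynomial_functions :: "complex set \<Rightarrow> (complex \<Rightarrow> complex) set" where
  "polynomial_functions X = {(\<lambda>z\<in>X. poly p z) | p. True}"

definition DF_R :: "complex set \<Rightarrow> cpath set \<Rightarrow> (complex \<Rightarrow> complex) set" where
  "DF_R X F = DF_closure X F (rational_functions X)"

definition DF_P :: "complex set \<Rightarrow> cpath set \<Rightarrow> (complex \<Rightarrow> complex) set" where
  "DF_P X F = DF_closure X F (polynomial_functions X)"

text \<open>``\<open>DF_space X F\<close> is the completion of \<open>D1_space X\<close>'' means that the latter is a dense
  subset of the former.\<close>
definition DF_is_completion_of_D1 :: "complex set \<Rightarrow> cpath set \<Rightarrow> bool" where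
  "DF_is_completion_of_D1 X F \<longleftrightarrow>
     D1_space X \<subseteq> DF_space X F \<and> DF_closure X F (D1_space X) = DF_space X F"

end

theory Submission
  imports Defs "HOL-Complex_Analysis.Complex_Analysis"
begin

text \<open>
  If \<open>g\<close> is an \<open>F\<close>-derivative of \<open>f\<close>, take a polynomial \<open>q\<close> uniformly close to \<open>g\<close> on \<open>X\<close>, which
  exists by Lavrentiev's theorem, and a primitive \<open>P\<close> of \<open>q\<close>. As the paths of \<open>F\<close> join the points of
  each component of \<open>X\<close> and have bounded length, \<open>f - P\<close> has small oscillation on each component,
  so it is uniformly close to a locally constant function, and locally constant functions are
  limits of polynomials whose derivatives tend to 0.

  For Lavrentiev's theorem it suffices, by Stone--Weierstrass, to approximate the conjugation.
  Over a grid of small squares, \<open>cnj z\<close> is, up to a holomorphic function and the factor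
  \<open>- 2 \<pi> \<i>\<close>, the sum of the integrals of \<open>(cnj w - cnj z) / (w - z)\<close> over the boundaries of the
  squares. The square of side \<open>d\<close> contributes a function bounded by \<open>O(d)\<close> and close to \<open>A / (z - a)\<close>
  far away, where \<open>a\<close> is a point off \<open>X\<close> near the square. Vitushkin's scheme replaces it by a
  function with the same two properties that is a uniform limit of polynomials on \<open>X\<close>; with \<open>n\<close>
  squares along each side the errors add up to \<open>O((ln n)\<^sup>2 / n)\<close>.
\<close>

section \<open>Uniform approximation by polynomials\<close>

text \<open>By Green's formula the edge integrals of a square add up to \<open>2 * \<i>\<close>
  times the area integral of \<open>1 / (w - z)\<close>. The boundary form is used because the
  squares then telescope to the outer boundary. The obstacle is that \<open>A / (z - a)\<close> is
  unbounded near \<open>a\<close>, which can be arbitrarily close to \<open>X\<close>, so it cannot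
  serve as approximant near the square. The pole is therefore spread over a connected set of size
  \<open>d\<close> that runs from \<open>a\<close> through the complement of \<open>X\<close>; here
  connectedness of the complement enters a second time, after pole pushing. The empty interior
  supplies \<open>a\<close> within \<open>d\<close> of each corner. Matching the coefficient of
  \<open>1 / (z - a)\<close> makes the errors summable: a square \<open>k\<close> cells away
  contributes \<open>O(d / k^2)\<close>, and about \<open>k\<close> squares lie at that distance.
  Agreement in size alone would leave \<open>O(d / k)\<close>, whose total does not become small, as
  \<open>d\<close> is about \<open>1 / n\<close>. For the second half, uniform closeness to a
  locally constant function does not control derivatives, so the polynomial for an indicator has to
  be flattened by a separate iteration.\<close>

definition poly_approx :: "complex set \<Rightarrow> (complex \<Rightarrow> complex) \<Rightarrow> bool" where
  "poly_approx X f \<longleftrightarrow> (\<forall>e>0. \<exists>p. \<forall>z\<in>X. cmod (f z - poly p z) < e)"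

section \<open>Closure properties of uniform limits of polynomials\<close>

lemma poly_approx_cong:
  assumes "poly_approx X f" "\<And>z. z \<in> X \<Longrightarrow> f z = g z"
  shows "poly_approx X g"
  using assms by (simp add: poly_approx_def)

lemma poly_approx_poly: "poly_approx X (poly p)"
  unfolding poly_approx_def by (intro allI impI exI[of _ p]) auto

lemma poly_approx_const: "poly_approx X (\<lambda>z. c)"
  by (rule poly_approx_cong[OF poly_approx_poly[of _ "[:c:]"]]) auto

lemma poly_approx_ident: "poly_approx X (\<lambda>z. z)"
  by (rule poly_approx_cong[OF poly_approx_poly[of _ "[:0,1:]"]]) auto

lemma poly_approx_closed:
  assumes "\<And>e. e > 0 \<Longrightarrow> \<exists>g. poly_approx X g \<and> (\<forall>z\<in>X. cmod (f z - g z) < e)"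
  shows "poly_approx X f"
  unfolding poly_approx_def
proof (intro allI impI)
  fix e :: real assume "e > 0"
  then obtain g where g: "poly_approx X g" "\<And>z. z \<in> X \<Longrightarrow> cmod (f z - g z) < e/2"
    using assms[of "e/2"] by auto
  obtain p where p: "\<And>z. z \<in> X \<Longrightarrow> cmod (g z - poly p z) < e/2"
    using g(1) \<open>e > 0\<close> unfolding poly_approx_def by (meson half_gt_zero)
  show "\<exists>p. \<forall>z\<in>X. cmod (f z - poly p z) < e"
    using norm_diff_triangle_less[OF g(2) p] by (intro exI[of _ p]) auto
qed

lemma poly_approx_add:
  assumes "poly_approx X f" "poly_approx X g"
  shows "poly_approx X (\<lambda>z. f z + g z)"
  unfolding poly_approx_def
proof (intro allI impI)
  fix e :: real assume "e > 0"
  obtain p where p: "\<And>z. z \<in> X \<Longrightarrow> cmod (f z - poly p z) < e/2"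
    using assms(1) \<open>e > 0\<close> unfolding poly_approx_def by (meson half_gt_zero)
  obtain q where q: "\<And>z. z \<in> X \<Longrightarrow> cmod (g z - poly q z) < e/2"
    using assms(2) \<open>e > 0\<close> unfolding poly_approx_def by (meson half_gt_zero)
  have "cmod (f z + g z - poly (p + q) z) < e" if "z \<in> X" for z
    using norm_add_less[OF p[OF that] q[OF that]] by (simp add: algebra_simps)
  then show "\<exists>p. \<forall>z\<in>X. cmod (f z + g z - poly p z) < e"
    by blast
qed

lemma poly_approx_bounded:
  assumes "compact X" "poly_approx X f"
  obtains B where "B > 0" "\<And>z. z \<in> X \<Longrightarrow> cmod (f z) \<le> B"
proof -
  obtain p where p: "\<And>z. z \<in> X \<Longrightarrow> cmod (f z - poly p z) < 1"
    using assms(2) unfolding poly_approx_def by (meson zero_less_one)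
  have "compact (poly p ` X)"
    by (intro compact_continuous_image continuous_intros assms)
  then obtain B where B: "B > 0" "\<And>z. z \<in> X \<Longrightarrow> cmod (poly p z) \<le> B"
    by (metis bounded_pos compact_imp_bounded imageI)
  have "cmod (f z) \<le> B + 1" if "z \<in> X" for z
    using p[OF that] B(2)[OF that] norm_triangle_ineq2[of "f z" "poly p z"] by linarith
  with \<open>B > 0\<close> show ?thesis
    by (intro that[of "B + 1"]) auto
qed

lemma poly_approx_mult:
  assumes "compact X" "poly_approx X f" "poly_approx X g"
  shows "poly_approx X (\<lambda>z. f z * g z)"
  unfolding poly_approx_def
proof (intro allI impI)
  fix e :: real assume "e > 0"
  obtain A where A: "A > 0" "\<And>z. z \<in> X \<Longrightarrow> cmod (f z) \<le> A"
    using poly_approx_bounded[OF assms(1,2)] by blast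
  \<comment> \<open>The approximant \<open>q\<close> of \<open>g\<close> is fixed first, because the
    tolerance for \<open>p\<close> depends on the bound \<open>B\<close> of \<open>q\<close>. The
    two error terms are then at most \<open>e/4\<close> and \<open>e/2\<close>.\<close>
  have "e / (4 * A) > 0" using A \<open>e > 0\<close> by auto
  then obtain q where q: "\<And>z. z \<in> X \<Longrightarrow> cmod (g z - poly q z) < e / (4 * A)"
    using assms(3) unfolding poly_approx_def by meson
  obtain B where B: "B > 0" "\<And>z. z \<in> X \<Longrightarrow> cmod (poly q z) \<le> B"
    using poly_approx_bounded[OF assms(1) poly_approx_poly] by blast
  have "e / (2 * B) > 0" using B \<open>e > 0\<close> by auto
  then obtain p where p: "\<And>z. z \<in> X \<Longrightarrow> cmod (f z - poly p z) < e / (2 * B)"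
    using assms(2) unfolding poly_approx_def by meson
  have "cmod (f z * g z - poly (p * q) z) < e" if "z \<in> X" for z
  proof -
    have "f z * g z - poly (p * q) z = f z * (g z - poly q z) + (f z - poly p z) * poly q z"
      by (simp add: algebra_simps)
    moreover have "cmod (f z * (g z - poly q z)) \<le> A * (e / (4 * A))"
      unfolding norm_mult
      by (intro mult_mono less_imp_le[OF q] A that) (use A(1) in auto)
    moreover have "cmod ((f z - poly p z) * poly q z) \<le> (e / (2 * B)) * B"
      unfolding norm_mult
      by (intro mult_mono less_imp_le[OF p] B that) (use \<open>e > 0\<close> B(1) in auto)
    ultimately show ?thesis
      using A B \<open>e > 0\<close> norm_triangle_ineq[of "f z * (g z - poly q z)" "(f z - poly p z) * poly q z"]
      by (simp add: field_simps)
  qed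
  then show "\<exists>p. \<forall>z\<in>X. cmod (f z * g z - poly p z) < e"
    by blast
qed

lemma poly_approx_power:
  assumes "compact X" "poly_approx X f"
  shows "poly_approx X (\<lambda>z. f z ^ n)"
  by (induction n) (auto intro: poly_approx_const poly_approx_mult assms)

lemma poly_approx_sum:
  assumes "\<And>i. i \<in> I \<Longrightarrow> poly_approx X (f i)"
  shows "poly_approx X (\<lambda>z. \<Sum>i\<in>I. f i z)"
  using assms by (induction I rule: infinite_finite_induct) (auto intro: poly_approx_const poly_approx_add)

lemma poly_approx_diff:
  assumes "compact X" "poly_approx X f" "poly_approx X g"
  shows "poly_approx X (\<lambda>z. f z - g z)"
  using poly_approx_add[OF assms(2) poly_approx_mult[OF assms(1) poly_approx_const[of _ "-1"] assms(3)]]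
  by simp

text \<open>The Taylor polynomials of \<open>f\<close> at 0 converge uniformly on
  \<open>cball 0 s\<close>, and a polynomial in \<open>u\<close> is again a limit of polynomials.
  The applications are geometric series, square roots near 1 and, with \<open>u\<close> the
  identity, functions holomorphic on a disc around \<open>X\<close>.\<close>

lemma poly_approx_holomorphic_compose:
  assumes "compact X" "poly_approx X u" "f holomorphic_on ball 0 r" "s < r"
    and us: "\<And>z. z \<in> X \<Longrightarrow> cmod (u z) \<le> s"
  shows "poly_approx X (\<lambda>z. f (u z))"
proof -
  define a where "a = (\<lambda>n. (deriv ^^ n) f 0 / fact n)"
  have sums: "(\<lambda>n. a n * w ^ n) sums f w" if "cmod w < r" for w
    using holomorphic_power_series[OF assms(3), of w] that by (simp add: a_def)
  show ?thesis
  proof (cases "X = {}")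
    case True
    then show ?thesis by (simp add: poly_approx_def)
  next
    case False
    then have "0 \<le> s" using us norm_ge_zero order_trans by blast
    \<comment> \<open>Convergence at one point beyond \<open>s\<close> puts the radius of
      convergence strictly above \<open>s\<close>, which uniform convergence on
      \<open>cball 0 s\<close> requires.\<close>
    define t where "t = (s + r) / 2"
    have t: "s < t" "t < r" "0 < t" using \<open>s < r\<close> \<open>0 \<le> s\<close> by (auto simp: t_def)
    have "summable (\<lambda>n. a n * of_real t ^ n)"
      using sums[of "of_real t"] t by (auto simp: sums_iff)
    then have "conv_radius a \<ge> ereal t"
      using conv_radius_geI[of a "of_real t"] t by simp
    then have cr: "ereal s < conv_radius a"
      using t by (metis ereal_less_le less_ereal.simps(1) order_less_le_trans)
    have ul: "uniform_limit (cball 0 s) (\<lambda>n x. \<Sum>i<n. a i * (x - 0) ^ i)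
                (\<lambda>x. suminf (\<lambda>i. a i * (x - 0) ^ i)) sequentially"
      by (rule powser_uniform_limit[OF cr])
    show ?thesis
    proof (rule poly_approx_closed)
      fix e :: real assume "e > 0"
      obtain N where N: "\<And>x. x \<in> cball 0 s \<Longrightarrow> dist (\<Sum>i<N. a i * (x - 0) ^ i) (suminf (\<lambda>i. a i * (x - 0) ^ i)) < e"
        using uniform_limitD[OF ul \<open>e > 0\<close>] unfolding eventually_sequentially by blast
      have "cmod (f (u z) - (\<Sum>i<N. a i * u z ^ i)) < e" if "z \<in> X" for z
        using N[of "u z"] us[OF that] sums[of "u z"] \<open>s < r\<close>
        by (auto simp: dist_norm norm_minus_commute sums_iff)
      moreover have "poly_approx X (\<lambda>z. \<Sum>i<N. a i * u z ^ i)"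
        by (intro poly_approx_sum poly_approx_mult poly_approx_const poly_approx_power assms)
      ultimately show "\<exists>g. poly_approx X g \<and> (\<forall>z\<in>X. cmod (f (u z) - g z) < e)"
        by blast
    qed
  qed
qed

section \<open>Poles and square roots with singularities off \<open>X\<close>\<close>

text \<open>Pole pushing along the complement, starting from infinity.\<close>

lemma poly_approx_pole:
  assumes "compact X" "connected (- X)" "\<zeta> \<notin> X"
  shows "poly_approx X (\<lambda>z. 1 / (z - \<zeta>))"
proof -
  \<comment> \<open>The bound 2/3 is the ratio that occurs in the induction below: two points of
    \<open>ball x (\<rho>/4)\<close> are at most \<open>\<rho>/2\<close> apart, and \<open>X\<close>
    keeps distance \<open>3/4 * \<rho>\<close> from each.\<close>
  have geom: "poly_approx X (\<lambda>z. 1 / (1 - u z))"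
    if "poly_approx X u" "\<And>z. z \<in> X \<Longrightarrow> cmod (u z) \<le> 2/3" for u
    by (rule poly_approx_holomorphic_compose[OF assms(1) that(1), of "\<lambda>w. 1 / (1 - w)" 1 "2/3"])
      (use that in \<open>auto intro!: holomorphic_intros\<close>)
  obtain R where R: "R > 0" "\<And>z. z \<in> X \<Longrightarrow> cmod z \<le> R"
    using compact_imp_bounded[OF assms(1)] by (auto simp: bounded_pos)
  define a :: complex where "a = of_real (2 * R)"
  have na: "cmod a = 2 * R" using R by (simp add: a_def)
  have "a \<notin> X" using R(2)[of a] na R(1) by auto
  have step: "poly_approx X (\<lambda>z. 1 / (z - y))"
    if x: "poly_approx X (\<lambda>z. 1 / (z - x))" and xy: "\<And>z. z \<in> X \<Longrightarrow> 3 * cmod (x - y) \<le> 2 * cmod (z - x) \<and> z \<noteq> x" for x y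
  proof -
    have u: "poly_approx X (\<lambda>z. (y - x) * (1 / (z - x)))"
      by (intro poly_approx_mult poly_approx_const x assms)
    have "poly_approx X (\<lambda>z. (1 / (z - x)) * (1 / (1 - (y - x) * (1 / (z - x)))))"
      by (intro poly_approx_mult[OF assms(1) x] geom u)
        (use xy in \<open>auto simp: norm_mult norm_divide divide_simps norm_minus_commute mult.commute\<close>)
    then show ?thesis
      by (rule poly_approx_cong) (use xy in \<open>auto simp: divide_simps\<close>)
  qed
  show ?thesis
  proof (rule connected_induction_simple[OF assms(2), where a = a and P = "\<lambda>\<zeta>. poly_approx X (\<lambda>z. 1 / (z - \<zeta>))"])
    show "a \<in> - X" "\<zeta> \<in> - X" using \<open>a \<notin> X\<close> assms(3) by auto
    have u: "poly_approx X (\<lambda>z. z * (1 / a))"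
      by (intro poly_approx_mult poly_approx_const poly_approx_ident assms)
    have "cmod (z * (1 / a)) \<le> 2 / 3" if "z \<in> X" for z
      using R(1) R(2)[OF that] na by (simp add: norm_divide divide_simps)
    then have "poly_approx X (\<lambda>z. (- 1 / a) * (1 / (1 - z * (1 / a))))"
      by (intro poly_approx_mult[OF assms(1) poly_approx_const] geom u)

    then show "poly_approx X (\<lambda>z. 1 / (z - a))"
      by (rule poly_approx_cong) (use \<open>a \<notin> X\<close> R in \<open>auto simp: divide_simps a_def\<close>)
  next
    fix x assume "x \<in> - X"
    moreover have "open (- X)"
      using assms(1) compact_imp_closed by blast
    ultimately obtain \<rho> where \<rho>: "\<rho> > 0" "ball x \<rho> \<subseteq> - X"
      by (meson openE)
    have "poly_approx X (\<lambda>z. 1 / (z - y'))"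
      if "y \<in> ball x (\<rho>/4)" "y' \<in> ball x (\<rho>/4)" "poly_approx X (\<lambda>z. 1 / (z - y))" for y y'
    proof (rule step[OF that(3)])
      fix z assume "z \<in> X"
      then have "dist x z \<ge> \<rho>" using \<rho> by (auto simp: subset_eq)
      then have "dist z y \<ge> 3 / 4 * \<rho>" "dist y y' \<le> \<rho> / 2"
        using that(1,2) dist_triangle[of x z y] dist_triangle[of y y' x]
        by (auto simp: dist_commute)
      then show "3 * cmod (y - y') \<le> 2 * cmod (z - y) \<and> z \<noteq> y"
        using \<rho>(1) by (auto simp: dist_norm)
    qed
    moreover have "ball x (\<rho>/4) \<subseteq> - X" "x \<in> ball x (\<rho>/4)"
      using \<rho> subset_ball[of "\<rho>/4" \<rho> x] by auto
    moreover have "openin (top_of_set (- X)) (ball x (\<rho>/4))"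
      using \<open>ball x (\<rho>/4) \<subseteq> - X\<close> by (simp add: open_subset)
    ultimately show "\<exists>T. openin (top_of_set (- X)) T \<and> x \<in> T \<and>
        (\<forall>y\<in>T. \<forall>y'\<in>T. poly_approx X (\<lambda>z. 1 / (z - y)) \<longrightarrow> poly_approx X (\<lambda>z. 1 / (z - y')))"
      by blast
  qed
qed

text \<open>\<open>v\<close> factors as \<open>(1 - r) * (1 + r)\<close>, and the second factor has
  norm at least 1. The sign of the real part selects the root near 1 rather than the one near
  -1.\<close>

lemma norm_one_minus_sqrt_le:
  fixes r v :: complex
  assumes "r\<^sup>2 = 1 - v" "Re r \<ge> 0"
  shows "cmod (1 - r) \<le> cmod v"
proof -
  have "v = (1 - r) * (1 + r)"
    using assms(1) by (simp add: power2_eq_square algebra_simps)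
  then have "cmod v = cmod (1 - r) * cmod (1 + r)"
    by (simp add: norm_mult)
  moreover have "cmod (1 + r) \<ge> 1"
    using complex_Re_le_cmod[of "1 + r"] assms(2) by simp
  ultimately show ?thesis
    by (metis mult.right_neutral mult_left_mono norm_ge_zero)
qed

text \<open>The branch is a product of principal square roots of \<open>(z - e') / (z - e)\<close> along a chain
  of points of \<open>E\<close> from \<open>a\<close> to \<open>b\<close>; the condition on the real part identifies it far away from \<open>E\<close>.\<close>

lemma poly_approx_sqrt_branch:
  fixes a b :: complex
  assumes X: "compact X" "connected (- X)"
    and E: "compact E" "connected E" "E \<inter> X = {}" "E \<subseteq> cball a d" "a \<in> E" "b \<in> E" and "d > 0"
  shows "\<exists>r. poly_approx X r \<and> (\<forall>z\<in>X. (r z)\<^sup>2 * (z - a) = z - b) \<and>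
             (\<forall>z\<in>X. 8 * d \<le> cmod (z - a) \<longrightarrow> 0 < Re (r z))"
    (is "?P b")
proof -
  obtain \<eta> where \<eta>: "\<eta> > 0" "\<And>e z. e \<in> E \<Longrightarrow> z \<in> X \<Longrightarrow> \<eta> \<le> dist e z"
    using separate_compact_closed[OF E(1) compact_imp_closed[OF X(1)] E(3)] by blast
  have step: "?P e'" if e: "e \<in> E" "e' \<in> E" "dist e e' \<le> \<eta> / 2" "?P e" for e e'
  proof -
    obtain r where r: "poly_approx X r" "\<And>z. z \<in> X \<Longrightarrow> (r z)\<^sup>2 * (z - a) = z - e"
        "\<And>z. z \<in> X \<Longrightarrow> 8 * d \<le> cmod (z - a) \<Longrightarrow> 0 < Re (r z)"
      using e(4) by blast
    \<comment> \<open>\<open>1 - u z\<close> equals \<open>(z - e') / (z - e)\<close>, so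
      multiplying \<open>r\<close> by its principal root moves the zero of
      \<open>(r z)\<^sup>2 * (z - a)\<close> from \<open>e\<close> to \<open>e'\<close>.\<close>
    define u where "u = (\<lambda>z. (e' - e) * (1 / (z - e)))"
    define \<rho> where "\<rho> = (\<lambda>z. csqrt (1 - u z))"
    have "e \<notin> X" "e' \<notin> X" "a \<notin> X" using E e by auto
    have u: "poly_approx X u"
      unfolding u_def using E(3) e(1)
      by (intro poly_approx_mult[OF X(1)] poly_approx_const poly_approx_pole X) auto
    have u2: "cmod (u z) \<le> 1 / 2" if "z \<in> X" for z
    proof -
      have "cmod (e' - e) \<le> \<eta> / 2" "\<eta> \<le> cmod (z - e)"
        using e(3) \<eta>(2)[OF e(1) that] by (simp_all add: dist_norm norm_minus_commute)
      then show ?thesis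
        using \<eta>(1) by (simp add: u_def norm_divide divide_simps)
    qed
    have \<rho>: "poly_approx X \<rho>"
      unfolding \<rho>_def
    proof (rule poly_approx_holomorphic_compose[OF X(1) u, of "\<lambda>w. csqrt (1 - w)" 1 "1/2"])
      show "(\<lambda>w. csqrt (1 - w)) holomorphic_on ball 0 1"
      proof (intro holomorphic_intros)
        fix w :: complex assume "w \<in> ball 0 1"
        then have "Re (1 - w) > 0"
          using complex_Re_le_cmod[of w] by simp
        then show "1 - w \<notin> \<real>\<^sub>\<le>\<^sub>0"
          by (auto simp: complex_nonpos_Reals_iff)
      qed
    qed (use u2 in auto)
    have "(r z * \<rho> z)\<^sup>2 * (z - a) = z - e'" if "z \<in> X" for z
    proof -
      have "z \<noteq> e" using that \<open>e \<notin> X\<close> by auto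
      have "(r z * \<rho> z)\<^sup>2 * (z - a) = (1 - u z) * ((r z)\<^sup>2 * (z - a))"
        by (simp add: \<rho>_def power_mult_distrib)
      also have "\<dots> = (1 - u z) * (z - e)"
        by (simp only: r(2)[OF that])
      also have "\<dots> = z - e'"
        using \<open>z \<noteq> e\<close> by (simp add: u_def field_simps)
      finally show ?thesis .
    qed
    \<comment> \<open>Products do not preserve positivity of the real part, so it is secured by
      numbers: \<open>1 - 1/8 - 1/2 - 1/16 > 0\<close>. The bound 1/8 does not degrade along the
      chain, because each step derives it afresh from the square of \<open>r z\<close> and the
      position of \<open>e\<close> in \<open>cball a d\<close>.\<close>
    moreover have "0 < Re (r z * \<rho> z)" if z: "z \<in> X" "8 * d \<le> cmod (z - a)" for z
    proof -
      have "z \<noteq> a" using z \<open>a \<notin> X\<close> by auto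
      have 1: "cmod (1 - r z) \<le> 1 / 8"
      proof (rule order_trans[OF norm_one_minus_sqrt_le[of _ "(e - a) / (z - a)"]])
        show "(r z)\<^sup>2 = 1 - (e - a) / (z - a)"
          using r(2)[OF z(1)] \<open>z \<noteq> a\<close> by (simp add: field_simps)
        show "0 \<le> Re (r z)" using r(3)[OF z] by simp
        have "cmod (e - a) \<le> d"
          using E(4) e(1) by (auto simp: dist_norm norm_minus_commute)
        then show "cmod ((e - a) / (z - a)) \<le> 1 / 8"
          using z(2) \<open>d > 0\<close> by (simp add: norm_divide divide_simps)
      qed
      have 2: "cmod (1 - \<rho> z) \<le> 1 / 2"
      proof (rule order_trans[OF norm_one_minus_sqrt_le[of "\<rho> z" "u z"] u2[OF z(1)]])
        show "(\<rho> z)\<^sup>2 = 1 - u z" by (simp add: \<rho>_def)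
        show "0 \<le> Re (\<rho> z)" unfolding \<rho>_def by (rule Re_csqrt)
      qed
      have "cmod ((1 - r z) * (1 - \<rho> z)) \<le> (1 / 8) * (1 / 2)"
        unfolding norm_mult by (intro mult_mono 1 2) auto
      moreover have "r z * \<rho> z = 1 - (1 - r z) - (1 - \<rho> z) + (1 - r z) * (1 - \<rho> z)"
        by (simp add: algebra_simps)
      then have "Re (r z * \<rho> z) = 1 - Re (1 - r z) - Re (1 - \<rho> z) + Re ((1 - r z) * (1 - \<rho> z))"
        by (simp only: minus_complex.sel plus_complex.sel one_complex.sel)
      ultimately show ?thesis
        using 1 2 abs_Re_le_cmod[of "1 - r z"] abs_Re_le_cmod[of "1 - \<rho> z"]
          abs_Re_le_cmod[of "(1 - r z) * (1 - \<rho> z)"] by linarith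
    qed
    ultimately show ?thesis
      by (intro exI[of _ "\<lambda>z. r z * \<rho> z"]) (auto intro: poly_approx_mult X r \<rho>)
  qed
  show ?thesis
  proof (rule connected_induction_simple[OF E(2), where a = a and P = ?P])
    show "a \<in> E" "b \<in> E" by fact+
    show "?P a"
      by (intro exI[of _ "\<lambda>z. 1"]) (auto intro: poly_approx_const)
  next
    fix e assume "e \<in> E"
    have "?P y" if "x \<in> E \<inter> ball e (\<eta> / 4)" "y \<in> E \<inter> ball e (\<eta> / 4)" "?P x" for x y
    proof (rule step[OF _ _ _ that(3)])
      show "x \<in> E" "y \<in> E" using that by auto
      have "dist e x < \<eta> / 4" "dist e y < \<eta> / 4" using that by auto
      then show "dist x y \<le> \<eta> / 2"
        using dist_triangle3[of x y e] by linarith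
    qed
    then have "\<forall>x\<in>E \<inter> ball e (\<eta> / 4). \<forall>y\<in>E \<inter> ball e (\<eta> / 4). ?P x \<longrightarrow> ?P y"
      by blast
    moreover have "openin (top_of_set E) (E \<inter> ball e (\<eta> / 4))"
      by (simp add: openin_open_Int)
    moreover have "e \<in> E \<inter> ball e (\<eta> / 4)"
      using \<open>e \<in> E\<close> \<eta>(1) by simp
    ultimately show "\<exists>T. openin (top_of_set E) T \<and> e \<in> T \<and> (\<forall>x\<in>T. \<forall>y\<in>T. ?P x \<longrightarrow> ?P y)"
      by blast
  qed
qed

text \<open>Bounded substitute for the pole at \<open>a\<close>: with \<open>m = (a + b)/2\<close>, the function
  \<open>(z - m) - sqrt ((z - a) (z - b))\<close> is bounded and behaves like
  \<open>(a - b)\<^sup>2 / (8 (z - a))\<close> at infinity; it takes the place of the Riemann map in Mergelyan's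
  lemma.\<close>

lemma poly_approx_bounded_pole:
  fixes a :: complex
  assumes X: "compact X" "connected (- X)" and "a \<notin> X" "d > 0"
  shows "\<exists>T. poly_approx X T \<and> (\<forall>z\<in>X. cmod (T z) \<le> 140 / d) \<and>
             (\<forall>z\<in>X. 8 * d \<le> cmod (z - a) \<longrightarrow> cmod (T z - 1 / (z - a)) \<le> 2 * d / (cmod (z - a))\<^sup>2)"
proof -
  have "open (- X)" using X(1) compact_imp_closed by blast
  then have "path_connected (- X)"
    using X(2) connected_open_path_connected by blast
  moreover obtain p where "p \<notin> X" "dist a p > d"
  proof -
    have "bounded (X \<union> cball a d)" using X(1) compact_imp_bounded by auto
    then obtain p where "p \<notin> X \<union> cball a d"
      by (metis UNIV_eq_I not_bounded_UNIV)
    with that show ?thesis by auto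
  qed
  ultimately obtain g where g: "path g" "path_image g \<subseteq> - X" "pathstart g = a" "pathfinish g = p"
    using \<open>a \<notin> X\<close> unfolding path_connected_def by (metis ComplI)
  \<comment> \<open>Cutting the path at the circle controls its size from both sides: the piece
    stays in \<open>cball a d\<close>, and its end \<open>b\<close> has distance exactly
    \<open>d\<close> from \<open>a\<close>, so that \<open>1 / (b - a)\<^sup>2\<close> below is of
    size \<open>1 / d\<^sup>2\<close>.\<close>
  obtain h where h: "path h" "pathstart h = a" "path_image h \<subseteq> path_image g \<inter> cball a d"
      "pathfinish h \<in> frontier (cball a d)"
    using exists_path_subpath_to_frontier_closed[of "cball a d" g] g \<open>d > 0\<close> \<open>dist a p > d\<close>
    by (metis centre_in_cball closed_cball less_imp_le mem_cball not_less)
  define b where "b = pathfinish h"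
  have ab: "cmod (b - a) = d"
    using h(4) \<open>d > 0\<close> by (simp add: b_def dist_norm norm_minus_commute)
  have "path_image h \<inter> X = {}" "path_image h \<subseteq> cball a d" "a \<in> path_image h" "b \<in> path_image h"
    using h g(2) pathstart_in_path_image[of h] by (auto simp: b_def)
  then obtain r where r: "poly_approx X r" "\<And>z. z \<in> X \<Longrightarrow> (r z)\<^sup>2 * (z - a) = z - b"
      "\<And>z. z \<in> X \<Longrightarrow> 8 * d \<le> cmod (z - a) \<Longrightarrow> 0 < Re (r z)"
    using poly_approx_sqrt_branch[OF X compact_path_image[OF h(1)] connected_path_image[OF h(1)], of a d b]
      \<open>d > 0\<close> by blast
  \<comment> \<open>\<open>(z - a) * r z\<close> is a square root of
    \<open>(z - a) * (z - b)\<close>, since \<open>(r z)\<^sup>2\<close> is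
    \<open>(z - b) / (z - a)\<close>. The factor in front normalises the coefficient of
    \<open>1 / (z - a)\<close> to 1.\<close>
  define T where "T = (\<lambda>z. (8 / (b - a)\<^sup>2) * ((z - (a + b) / 2) - (z - a) * r z))"
  have "poly_approx X T"
    unfolding T_def
    by (intro poly_approx_mult poly_approx_diff poly_approx_const poly_approx_ident X r)
  moreover have far: "cmod (T z - 1 / (z - a)) \<le> 2 * d / (cmod (z - a))\<^sup>2"
    if z: "z \<in> X" "8 * d \<le> cmod (z - a)" for z
  proof -
    have "z \<noteq> a" using z \<open>a \<notin> X\<close> by auto
    have "b \<noteq> a" using ab \<open>d > 0\<close> by auto
    define y where "y = z - a"
    define v where "v = (b - a) / y"
    have y: "y \<noteq> 0" "v \<noteq> 0" using \<open>z \<noteq> a\<close> \<open>b \<noteq> a\<close> by (auto simp: y_def v_def)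
    have v: "cmod v = d / cmod y" "cmod v \<le> 1 / 8"
      using z(2) \<open>d > 0\<close> by (auto simp: v_def norm_divide ab y_def divide_simps)
    have rv: "(r z)\<^sup>2 = 1 - v"
      using r(2)[OF z(1)] \<open>z \<noteq> a\<close> by (simp add: field_simps v_def y_def)
    have rz: "Re (r z) > 0" using r(3) z by blast
    have ba: "b - a = v * y" using y by (simp add: v_def)
    have "T z = 8 / (v * y)\<^sup>2 * (y - (b - a) / 2 - y * r z)"
      unfolding T_def ba[symmetric] by (simp add: y_def field_simps)
    also have "\<dots> = 8 * (1 - v / 2 - r z) / (y * v\<^sup>2)"
      unfolding ba using y by (simp add: field_simps power2_eq_square)
    finally have Ty: "T z * y * v\<^sup>2 = 8 * (1 - v / 2 - r z)"
      using y by simp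
    \<comment> \<open>Rationalising with \<open>1 - v / 2 + r z\<close> replaces an expansion of the
      square root: \<open>(1 - v / 2)\<^sup>2 - (1 - v)\<close> is
      \<open>v\<^sup>2 / 4\<close>.\<close>
    have "(T z * y * (1 - v / 2 + r z)) * v\<^sup>2 = 8 * (1 - v / 2 - r z) * (1 - v / 2 + r z)"
      unfolding Ty[symmetric] by (simp add: algebra_simps)
    also have "\<dots> = 8 * ((1 - v / 2)\<^sup>2 - (r z)\<^sup>2)"
      by (simp add: power2_eq_square algebra_simps)
    also have "\<dots> = 2 * v\<^sup>2"
      unfolding rv by (simp add: power2_eq_square algebra_simps)
    finally have two: "T z * y * (1 - v / 2 + r z) = 2"
      using y by simp
    have "(T z * y - 1) * (1 - v / 2 + r z) = 1 - r z + v / 2"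
      using two by (simp add: algebra_simps)
    then have "cmod (T z * y - 1) * cmod (1 - v / 2 + r z) = cmod (1 - r z + v / 2)"
      by (metis norm_mult)
    also have "\<dots> \<le> cmod (1 - r z) + cmod v / 2"
      using norm_triangle_ineq[of "1 - r z" "v / 2"] by (simp add: norm_divide)
    also have "\<dots> \<le> 3 / 2 * cmod v"
      using norm_one_minus_sqrt_le[OF rv] rz by simp
    finally have le: "cmod (T z * y - 1) * cmod (1 - v / 2 + r z) \<le> 3 / 2 * cmod v" .
    have "3 / 4 \<le> Re (1 - v / 2 + r z)"
      using rz v(2) abs_Re_le_cmod[of v] by simp
    then have "3 / 4 \<le> cmod (1 - v / 2 + r z)"
      using complex_Re_le_cmod order_trans by blast
    then have "cmod (T z * y - 1) * (3 / 4) \<le> 3 / 2 * cmod v"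
      using le mult_left_mono[of "3/4" "cmod (1 - v / 2 + r z)" "cmod (T z * y - 1)"] by simp
    then have "cmod (T z * y - 1) \<le> 2 * cmod v" by simp
    moreover have "T z - 1 / (z - a) = (T z * y - 1) / y"
      using y by (simp add: y_def field_simps)
    ultimately have "cmod (T z - 1 / (z - a)) \<le> 2 * cmod v / cmod y"
      by (simp add: norm_divide divide_right_mono)
    then show ?thesis
      by (simp add: v y_def power2_eq_square)
  qed
  moreover have "cmod (T z) \<le> 140 / d" if z: "z \<in> X" for z
  proof (cases "8 * d \<le> cmod (z - a)")
    case True
    have "cmod (T z) \<le> cmod (T z - 1 / (z - a)) + cmod (1 / (z - a))"
      using norm_triangle_ineq[of "T z - 1 / (z - a)" "1 / (z - a)"] by simp
    also have "\<dots> \<le> 2 * d / (cmod (z - a))\<^sup>2 + 1 / cmod (z - a)"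
      using far[OF z True] by (simp add: norm_divide)
    also have "\<dots> \<le> 2 * d / (8 * d)\<^sup>2 + 1 / (8 * d)"
      using True \<open>d > 0\<close> by (intro add_mono divide_left_mono power_mono mult_pos_pos) auto
    also have "\<dots> \<le> 140 / d"
      using \<open>d > 0\<close> by (simp add: divide_simps power2_eq_square)
    finally show ?thesis .
  next
    case False
    have zb: "cmod (z - b) \<le> 9 * d"
      using False ab norm_triangle_ineq4[of "z - a" "b - a"] by simp
    \<comment> \<open>The norm of the product is the geometric mean of two distances of at most
      \<open>9 * d\<close>. With \<open>17/2 * d\<close> for the polynomial part the total is
      \<open>35/2 * d\<close>, and \<open>8 * 35/2 = 140\<close>.\<close>
    have "(cmod ((z - a) * r z))\<^sup>2 = cmod ((r z)\<^sup>2 * (z - a)) * cmod (z - a)"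
      by (simp add: norm_mult norm_power power2_eq_square)
    also have "\<dots> = cmod (z - b) * cmod (z - a)"
      using r(2)[OF z] by simp
    also have "\<dots> \<le> (9 * d) * (9 * d)"
      by (rule mult_mono[OF zb]) (use False \<open>d > 0\<close> in auto)
    also have "\<dots> = (9 * d)\<^sup>2" by (simp add: power2_eq_square)
    finally have s: "cmod ((z - a) * r z) \<le> 9 * d"
      by (rule power2_le_imp_le) (use \<open>d > 0\<close> in simp)
    have m: "z - (a + b) / 2 = (z - a) - (b - a) / 2" by (simp add: field_simps)
    have "cmod (z - (a + b) / 2) \<le> cmod (z - a) + d / 2"
    proof -
      have "cmod ((z - a) - (b - a) / 2) \<le> cmod (z - a) + cmod ((b - a) / 2)"
        by (rule norm_triangle_ineq4)
      also have "cmod ((b - a) / 2) = d / 2"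
        using ab by (simp add: norm_divide)
      finally show ?thesis unfolding m .
    qed
    then have "cmod ((z - (a + b) / 2) - (z - a) * r z) \<le> 35 / 2 * d"
      using norm_triangle_ineq4[of "z - (a + b) / 2" "(z - a) * r z"] s False by linarith
    then have "cmod (T z) \<le> 8 / d\<^sup>2 * (35 / 2 * d)"
      unfolding T_def norm_mult norm_divide norm_power ab
      by (intro mult_mono) auto
    also have "\<dots> = 140 / d" using \<open>d > 0\<close> by (simp add: power2_eq_square)
    finally show ?thesis .
  qed
  ultimately show ?thesis by blast
qed

section \<open>Lavrentiev's theorem\<close>

text \<open>Around a closed curve that avoids \<open>z\<close> these integrals give the Cauchy
  integral of \<open>cnj\<close> minus \<open>2 * of_real pi * \<i> * cnj z\<close> times the
  winding number. The combined integrand stays bounded near \<open>w = z\<close>, so the grid lines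
  may run through \<open>X\<close>.\<close>

definition edge :: "complex \<Rightarrow> complex \<Rightarrow> complex \<Rightarrow> complex" where
  "edge p q z = contour_integral (linepath p q) (\<lambda>w. (cnj w - cnj z) / (w - z))"

text \<open>The edge functional is a parameter because the expansion at infinity sums further
  functionals over the same four edges.\<close>

definition square_sum :: "(complex \<Rightarrow> complex \<Rightarrow> complex) \<Rightarrow> complex \<Rightarrow> real \<Rightarrow> complex" where
  "square_sum I c d =
     I c (c + of_real d) + I (c + of_real d) (c + of_real d + \<i> * of_real d) +
     I (c + of_real d + \<i> * of_real d) (c + \<i> * of_real d) + I (c + \<i> * of_real d) c"

section \<open>Edge integrals and their sum over one small square\<close>

lemma edge_reverse: "edge q p z = - edge p q z"
  unfolding edge_def by (metis contour_integral_reversepath reversepath_linepath valid_path_linepath)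

text \<open>The non-integrable case is harmless because the integral is then 0 by definition; so the
  bound covers edges through \<open>z\<close>.\<close>

lemma norm_contour_integral_linepath_le:
  assumes "0 \<le> B" "\<And>w. w \<in> closed_segment p q \<Longrightarrow> cmod (f w) \<le> B"
  shows "cmod (contour_integral (linepath p q) f) \<le> B * cmod (q - p)"
proof (cases "f contour_integrable_on linepath p q")
  case True
  then show ?thesis
    using has_contour_integral_bound_linepath[OF has_contour_integral_integral[OF True] assms] by simp
next
  case False
  then show ?thesis
    using assms(1) by (simp add: not_integrable_contour_integral)
qed

text \<open>No condition on \<open>z\<close>: the integrand has norm at most 1, also when the edge contains \<open>z\<close>
  (at \<open>w = z\<close> it is 0, as division by 0 gives 0).\<close>

lemma norm_edge_le: "cmod (edge p q z) \<le> cmod (q - p)"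
  using norm_contour_integral_linepath_le[of 1 p q "\<lambda>w. (cnj w - cnj z) / (w - z)"]
  unfolding edge_def by (simp add: norm_divide complex_cnj_diff[symmetric] del: complex_cnj_diff)

lemma edge_eq:
  assumes "z \<notin> closed_segment p q"
  shows "edge p q z = contour_integral (linepath p q) (\<lambda>w. cnj w / (w - z)) -
           cnj z * contour_integral (linepath p q) (\<lambda>w. 1 / (w - z))"
proof -
  have i1: "(\<lambda>w. cnj w / (w - z)) contour_integrable_on linepath p q"
    using assms by (intro contour_integrable_continuous_linepath continuous_intros) auto
  have i2: "(\<lambda>w. 1 / (w - z)) contour_integrable_on linepath p q"
    using assms by (intro contour_integrable_continuous_linepath continuous_intros) auto
  have "(\<lambda>w. (cnj w - cnj z) / (w - z)) = (\<lambda>w. cnj w / (w - z) - cnj z * (1 / (w - z)))"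
    by (simp add: diff_divide_distrib)
  then show ?thesis
    unfolding edge_def
    using contour_integral_diff[OF i1 contour_integrable_lmul[OF i2, of "cnj z"]]
      contour_integral_lmul[OF i2, of "cnj z"] by simp
qed

text \<open>Write \<open>cnj w - cnj z\<close> as \<open>cnj (w - a) + cnj (a - z)\<close> and
  expand \<open>1 / (w - z)\<close> once about \<open>a\<close> in the first term; the remainder is
  \<open>cnj (w - a) * (w - a) / ((w - z) * (z - a))\<close>. The term with
  \<open>cnj (a - z)\<close> does not decay, but its integral vanishes round a square.\<close>

lemma edge_expansion:
  assumes seg: "closed_segment p q \<subseteq> cball a D" and D: "0 < D" "2 * D \<le> cmod (z - a)"
  shows "cmod (edge p q z + contour_integral (linepath p q) (\<lambda>w. cnj (w - a)) / (z - a)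
             - cnj (a - z) * contour_integral (linepath p q) (\<lambda>w. 1 / (w - z)))
         \<le> 2 * D\<^sup>2 / (cmod (z - a))\<^sup>2 * cmod (q - p)" (is "cmod ?L \<le> _")
proof -
  have far: "cmod (z - a) / 2 \<le> cmod (w - z)" "cmod (w - a) \<le> D" if "w \<in> closed_segment p q" for w
  proof -
    show 1: "cmod (w - a) \<le> D"
      using seg that by (auto simp: dist_norm norm_minus_commute)
    have "cmod (z - a) \<le> cmod (w - a) + cmod (w - z)"
      using norm_triangle_ineq4[of "w - a" "w - z"] by simp
    then show "cmod (z - a) / 2 \<le> cmod (w - z)"
      using 1 D by simp
  qed
  have nz: "z \<notin> closed_segment p q" "z \<noteq> a"
    using far(1)[of z] D by auto
  have i1: "(\<lambda>w. (cnj w - cnj z) / (w - z)) contour_integrable_on linepath p q"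
    and i2: "(\<lambda>w. cnj (w - a)) contour_integrable_on linepath p q"
    and i3: "(\<lambda>w. 1 / (w - z)) contour_integrable_on linepath p q"
    using nz by (intro contour_integrable_continuous_linepath continuous_intros; auto)+
  have "((\<lambda>w. (cnj w - cnj z) / (w - z) + cnj (w - a) / (z - a) - cnj (a - z) * (1 / (w - z)))
          has_contour_integral ?L) (linepath p q)"
    unfolding edge_def
    by (intro has_contour_integral_diff has_contour_integral_add has_contour_integral_div
        has_contour_integral_lmul has_contour_integral_integral i1 i2 i3)
  then show ?thesis
  proof (rule has_contour_integral_bound_linepath)
    fix w assume w: "w \<in> closed_segment p q"
    then have "w \<noteq> z" using nz by auto
    have "(P - Q) / W + (P - R) / Y - (R - Q) * (1 / W) = (P - R) * (W + Y) / (W * Y)"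
      if "W \<noteq> 0" "Y \<noteq> 0" for P Q R W Y :: complex
      using that by (simp add: field_simps)
    from this[of "w - z" "z - a" "cnj w" "cnj z" "cnj a"]
    have "(cnj w - cnj z) / (w - z) + cnj (w - a) / (z - a) - cnj (a - z) * (1 / (w - z))
        = cnj (w - a) * (w - a) / ((w - z) * (z - a))"
      using nz \<open>w \<noteq> z\<close> by simp
    also have "cmod \<dots> = cmod (w - a) * cmod (w - a) / (cmod (w - z) * cmod (z - a))"
      by (simp add: norm_mult norm_divide del: complex_cnj_diff)
    also have "\<dots> \<le> D * D / (cmod (z - a) / 2 * cmod (z - a))"
      using far[OF w] D by (intro frac_le mult_mono mult_pos_pos) auto
    also have "\<dots> = 2 * D\<^sup>2 / (cmod (z - a))\<^sup>2"
      by (simp add: power2_eq_square)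
    finally show "cmod ((cnj w - cnj z) / (w - z) + cnj (w - a) / (z - a) - cnj (a - z) * (1 / (w - z)))
        \<le> 2 * D\<^sup>2 / (cmod (z - a))\<^sup>2" .
  qed simp
qed

lemma square_edges:
  fixes c a :: complex
  assumes "0 \<le> d" "cmod (a - c) \<le> d"
  shows "closed_segment c (c + of_real d) \<subseteq> cball a (3 * d)"
    "closed_segment (c + of_real d) (c + of_real d + \<i> * of_real d) \<subseteq> cball a (3 * d)"
    "closed_segment (c + of_real d + \<i> * of_real d) (c + \<i> * of_real d) \<subseteq> cball a (3 * d)"
    "closed_segment (c + \<i> * of_real d) c \<subseteq> cball a (3 * d)"
proof -
  have d: "cmod (of_real d) = d" "cmod (\<i> * of_real d) = d"
    using assms by (auto simp: norm_mult)
  have *: "c + x + y \<in> cball a (3 * d)" if "cmod x \<le> d" "cmod y \<le> d" for x y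
    using norm_triangle_ineq4[of "a - c" "x + y"] norm_triangle_ineq[of x y] that assms
    by (simp add: dist_norm algebra_simps)
  have "c \<in> cball a (3 * d)" "c + of_real d \<in> cball a (3 * d)"
    "c + of_real d + \<i> * of_real d \<in> cball a (3 * d)" "c + \<i> * of_real d \<in> cball a (3 * d)"
    using *[of 0 0] *[of "of_real d" 0] *[of "of_real d" "\<i> * of_real d"] *[of "\<i> * of_real d" 0] d assms(1)
    by simp_all
  then show "closed_segment c (c + of_real d) \<subseteq> cball a (3 * d)"
    "closed_segment (c + of_real d) (c + of_real d + \<i> * of_real d) \<subseteq> cball a (3 * d)"
    "closed_segment (c + of_real d + \<i> * of_real d) (c + \<i> * of_real d) \<subseteq> cball a (3 * d)"
    "closed_segment (c + \<i> * of_real d) c \<subseteq> cball a (3 * d)"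
    by (simp_all add: closed_segment_subset)
qed

text \<open>The witness for \<open>A\<close> is the integral of \<open>cnj (w - a)\<close> round the
  square, in fact \<open>2 * \<i> * d\<^sup>2\<close>; its bound comes from four edges of length
  \<open>d\<close> with integrand at most \<open>3 * d\<close>. The error is four times
  \<open>2 * (3 * d)\<^sup>2 * d\<close>, over the squared distance.\<close>

lemma square_sum_edge_expansion:
  fixes c a :: complex
  assumes d: "0 < d" and ac: "cmod (a - c) \<le> d"
  obtains A where "cmod A \<le> 12 * d\<^sup>2"
    "\<And>z. 8 * d \<le> cmod (z - a) \<Longrightarrow>
       cmod (square_sum (\<lambda>p q. edge p q z) c d + A / (z - a)) \<le> 72 * d ^ 3 / (cmod (z - a))\<^sup>2"
proof -
  define J where "J = (\<lambda>p q. contour_integral (linepath p q) (\<lambda>w. cnj (w - a)))"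
  note seg = square_edges[OF less_imp_le[OF d] ac]
  have len: "cmod (c + of_real d - c) = d" "cmod (c + of_real d + \<i> * of_real d - (c + of_real d)) = d"
     "cmod (c + \<i> * of_real d - (c + of_real d + \<i> * of_real d)) = d" "cmod (c - (c + \<i> * of_real d)) = d"
    using d by (simp_all add: norm_mult)
  have J: "cmod (J p q) \<le> 3 * d\<^sup>2" if "closed_segment p q \<subseteq> cball a (3 * d)" "cmod (q - p) = d" for p q
    using norm_contour_integral_linepath_le[of "3 * d" p q "\<lambda>w. cnj (w - a)"] that d
    by (fastforce simp: J_def dist_norm norm_minus_commute power2_eq_square mult.assoc simp flip: complex_cnj_diff)
  have "cmod (square_sum J c d) \<le> 3 * d\<^sup>2 + 3 * d\<^sup>2 + 3 * d\<^sup>2 + 3 * d\<^sup>2"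
    unfolding square_sum_def
    by (intro norm_triangle_le add_mono J seg len)
  then have "cmod (square_sum J c d) \<le> 12 * d\<^sup>2" by simp
  moreover have "cmod (square_sum (\<lambda>p q. edge p q z) c d + square_sum J c d / (z - a))
      \<le> 72 * d ^ 3 / (cmod (z - a))\<^sup>2" if z: "8 * d \<le> cmod (z - a)" for z
  proof -
    define K where "K = (\<lambda>p q. contour_integral (linepath p q) (\<lambda>w. 1 / (w - z)))"
    \<comment> \<open>\<open>1 / (w - z)\<close> has a primitive on a disc that contains the square
      and not \<open>z\<close>, so its four edge integrals telescope to 0.\<close>
    have "(\<lambda>w. 1 / (w - z)) holomorphic_on ball a (4 * d)"
      using z d by (intro holomorphic_intros) (auto simp: dist_norm norm_minus_commute)
    then obtain g where g: "\<And>x. x \<in> ball a (4 * d) \<Longrightarrow>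
        (g has_field_derivative 1 / (x - z)) (at x within ball a (4 * d))"
      using holomorphic_convex_primitive'[of "ball a (4 * d)"] by (metis convex_ball open_ball)
    have K: "K p q = g q - g p" if "closed_segment p q \<subseteq> cball a (3 * d)" for p q
    proof -
      have "closed_segment p q \<subseteq> ball a (4 * d)"
        using that d by (fastforce simp: subset_eq)
      then show ?thesis
        unfolding K_def
        using contour_integral_primitive[of "ball a (4 * d)" g "\<lambda>w. 1 / (w - z)" "linepath p q"] g
        by (intro contour_integral_unique) auto
    qed
    have K0: "square_sum K c d = 0"
      unfolding square_sum_def K[OF seg(1)] K[OF seg(2)] K[OF seg(3)] K[OF seg(4)] by simp
    have E: "cmod (edge p q z + J p q / (z - a) - cnj (a - z) * K p q) \<le> 18 * d ^ 3 / (cmod (z - a))\<^sup>2"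
      if "closed_segment p q \<subseteq> cball a (3 * d)" "cmod (q - p) = d" for p q
      using edge_expansion[OF that(1)] z d that(2)
      by (simp add: J_def K_def power_mult_distrib power2_eq_square power3_eq_cube mult.assoc)
    have "square_sum (\<lambda>p q. edge p q z) c d + square_sum J c d / (z - a)
      = square_sum (\<lambda>p q. edge p q z) c d + square_sum J c d / (z - a) - cnj (a - z) * square_sum K c d"
      by (simp add: K0)
    also have "\<dots> = square_sum (\<lambda>p q. edge p q z + J p q / (z - a) - cnj (a - z) * K p q) c d"
      unfolding square_sum_def by (simp add: algebra_simps add_divide_distrib)
    also have "cmod \<dots> \<le> 18 * d ^ 3 / (cmod (z - a))\<^sup>2 + 18 * d ^ 3 / (cmod (z - a))\<^sup>2 +
        18 * d ^ 3 / (cmod (z - a))\<^sup>2 + 18 * d ^ 3 / (cmod (z - a))\<^sup>2"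
      unfolding square_sum_def
      by (intro norm_triangle_le add_mono E seg len)
    finally show ?thesis by simp
  qed
  ultimately show ?thesis by (rule that)
qed

lemma norm_square_sum_edge_le:
  assumes "0 \<le> d"
  shows "cmod (square_sum (\<lambda>p q. edge p q z) c d) \<le> 4 * d"
proof -
  have "cmod (square_sum (\<lambda>p q. edge p q z) c d) \<le> d + d + d + d"
    unfolding square_sum_def
    by (intro norm_triangle_le add_mono order_trans[OF norm_edge_le]) (use assms in \<open>simp_all add: norm_mult\<close>)
  then show ?thesis by simp
qed

text \<open>The approximant is \<open>- A * T\<close>. Near the square both functions are of order
  \<open>d\<close>; far away both are within \<open>O(d^3 / |z - a|^2)\<close> of
  \<open>- A / (z - a)\<close>. The right-hand side merges the two regimes in a form that can be
  summed over the grid.\<close>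

lemma square_piece_approx:
  assumes X: "compact X" "connected (- X)" "interior X = {}" and d: "0 < d"
  shows "\<exists>H. poly_approx X H \<and>
    (\<forall>z\<in>X. cmod (square_sum (\<lambda>p q. edge p q z) c d - H z) \<le> 168400 * d / (1 + cmod (z - c) / d)\<^sup>2)"
proof -
  obtain a where a: "a \<notin> X" "cmod (a - c) < d"
  proof -
    have "\<not> ball c d \<subseteq> X"
      using X(3) d by (metis centre_in_ball empty_iff interiorI open_ball)
    then obtain a where "a \<in> ball c d" "a \<notin> X" by blast
    then show ?thesis using that[of a] by (simp add: dist_norm norm_minus_commute)
  qed
  obtain T where T: "poly_approx X T" "\<And>z. z \<in> X \<Longrightarrow> cmod (T z) \<le> 140 / d"
    "\<And>z. z \<in> X \<Longrightarrow> 8 * d \<le> cmod (z - a) \<Longrightarrow> cmod (T z - 1 / (z - a)) \<le> 2 * d / (cmod (z - a))\<^sup>2"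
    using poly_approx_bounded_pole[OF X(1,2) a(1) d] by blast
  obtain A where A: "cmod A \<le> 12 * d\<^sup>2" "\<And>z. 8 * d \<le> cmod (z - a) \<Longrightarrow>
       cmod (square_sum (\<lambda>p q. edge p q z) c d + A / (z - a)) \<le> 72 * d ^ 3 / (cmod (z - a))\<^sup>2"
    using square_sum_edge_expansion[OF d less_imp_le[OF a(2)]] by blast
  let ?S = "\<lambda>z. square_sum (\<lambda>p q. edge p q z) c d"
  have "cmod (?S z - (- A) * T z) \<le> 168400 * d / (1 + cmod (z - c) / d)\<^sup>2" if z: "z \<in> X" for z
  proof (cases "8 * d \<le> cmod (z - a)")
    case True
    let ?y = "cmod (z - a)"
    have y: "?y > 0" using True d by linarith
    have "?S z - (- A) * T z = (?S z + A / (z - a)) + A * (T z - 1 / (z - a))"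
      by (simp add: algebra_simps)
    also have "cmod \<dots> \<le> cmod (?S z + A / (z - a)) + cmod (A * (T z - 1 / (z - a)))"
      by (rule norm_triangle_ineq)
    also have "\<dots> \<le> 72 * d ^ 3 / ?y\<^sup>2 + 12 * d\<^sup>2 * (2 * d / ?y\<^sup>2)"
      unfolding norm_mult by (intro add_mono mult_mono A T z True) (use d in auto)
    also have "\<dots> = 96 * d / (?y / d)\<^sup>2"
      using d y by (simp add: power2_eq_square power3_eq_cube field_simps)
    also have "\<dots> \<le> 168400 * d / (1 + cmod (z - c) / d)\<^sup>2"
    proof -
      have "cmod (z - c) \<le> ?y + d"
        using norm_triangle_ineq[of "z - a" "a - c"] a(2) by simp
      then have "cmod (z - c) / d \<le> (?y + d) / d"
        using d by (intro divide_right_mono) auto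
      then have "1 + cmod (z - c) / d \<le> 2 + ?y / d"
        using d by (simp add: add_divide_distrib)
      also have "\<dots> \<le> 2 * (?y / d)"
        using True d by (simp add: field_simps)
      finally have "(1 + cmod (z - c) / d)\<^sup>2 \<le> (2 * (?y / d))\<^sup>2"
        using d by (intro power_mono) auto
      then have "(1 + cmod (z - c) / d)\<^sup>2 \<le> 4 * (?y / d)\<^sup>2"
        by (simp only: power_mult_distrib) simp
      moreover have "(1 + cmod (z - c) / d)\<^sup>2 > 0"
        using d by (intro zero_less_power add_pos_nonneg) auto
      ultimately have "168400 * d / (4 * (?y / d)\<^sup>2) \<le> 168400 * d / (1 + cmod (z - c) / d)\<^sup>2"
        using d by (intro divide_left_mono mult_pos_pos) auto
      moreover have "96 * d / (?y / d)\<^sup>2 \<le> 42100 * d / (?y / d)\<^sup>2"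
        using d by (intro divide_right_mono) auto
      ultimately show ?thesis by simp
    qed
    finally show ?thesis .
  next
    case False
    have "cmod (?S z - (- A) * T z) \<le> cmod (?S z) + cmod A * cmod (T z)"
      using norm_triangle_ineq4[of "?S z" "(- A) * T z"] by (simp add: norm_mult)
    also have "\<dots> \<le> 4 * d + 12 * d\<^sup>2 * (140 / d)"
      by (intro add_mono mult_mono A T z norm_square_sum_edge_le) (use d in auto)
    \<comment> \<open>\<open>4 + 12 * 140 = 1684\<close>, and \<open>1 + |z - c| / d\<close> is at
      most 10 here, which fixes the constant. The far case would do with 384 in its place.\<close>
    also have "\<dots> = 168400 * d / 10\<^sup>2"
      using d by (simp add: power2_eq_square)
    also have "\<dots> \<le> 168400 * d / (1 + cmod (z - c) / d)\<^sup>2"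
    proof -
      have "cmod (z - c) \<le> 9 * d"
        using norm_triangle_ineq[of "z - a" "a - c"] a(2) False by simp
      then have "(1 + cmod (z - c) / d)\<^sup>2 \<le> 10\<^sup>2"
        using d by (intro power_mono) (auto simp: field_simps)
      moreover have "(1 + cmod (z - c) / d)\<^sup>2 > 0"
        using d by (intro zero_less_power add_pos_nonneg) auto
      ultimately show ?thesis
        using d by (intro divide_left_mono mult_pos_pos) auto
    qed
    finally show ?thesis .
  qed
  moreover have "poly_approx X (\<lambda>z. (- A) * T z)"
    by (intro poly_approx_mult X poly_approx_const T)
  ultimately show ?thesis by blast
qed

text \<open>Splitting uses an integrand continuous on the segment, hence \<open>z\<close> off it. It
  is applied to the outer boundary of the grid; inner edges cancel in pairs instead.\<close>

lemma edge_subdivide: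
  assumes z: "z \<notin> closed_segment p q" and n: "n > 0"
  shows "(\<Sum>i<n. edge (p + of_real (real i / real n) * (q - p)) (p + of_real (real (Suc i) / real n) * (q - p)) z)
         = edge p q z"
proof -
  define P where "P = (\<lambda>i. p + of_real (real i / real n) * (q - p))"
  have seg: "u + of_real t * (v - u) \<in> closed_segment u v" if "0 \<le> t" "t \<le> 1" for u v :: complex and t
    unfolding in_segment using that
    by (intro exI[of _ t]) (simp add: scaleR_conv_of_real algebra_simps)
  have "(\<Sum>i<m. edge (P i) (P (Suc i)) z) = edge p (P m) z" if "m \<le> n" for m
    using that
  proof (induction m)
    case 0
    have "edge p p z = 0" using norm_edge_le[of p p z] by simp
    then show ?case by (simp add: P_def)
  next
    case (Suc m)
    have "P (Suc m) \<in> closed_segment p q"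
      unfolding P_def using Suc.prems n by (intro seg) (auto simp: field_simps)
    then have "closed_segment p (P (Suc m)) \<subseteq> closed_segment p q"
      by (intro closed_segment_subset) auto
    then have "z \<notin> closed_segment p (P (Suc m))" using z by blast
    then have "continuous_on (closed_segment p (P (Suc m))) (\<lambda>w. (cnj w - cnj z) / (w - z))"
      by (intro continuous_intros) auto
    moreover have "P m \<in> closed_segment p (P (Suc m))"
    proof -
      have "P m = p + of_real (real m / real (Suc m)) * (P (Suc m) - p)"
        unfolding P_def by (simp del: of_nat_Suc)
      then show ?thesis
        using seg[of "real m / real (Suc m)" p "P (Suc m)"] by simp
    qed
    ultimately have "edge p (P (Suc m)) z = edge p (P m) z + edge (P m) (P (Suc m)) z"
      unfolding edge_def by (rule contour_integral_split_linepath)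
    then show ?case using Suc by simp
  qed
  from this[of n] show ?thesis
    using n by (simp add: P_def)
qed

lemma holomorphic_linepath_cauchy_integral:
  assumes "open S" "S \<inter> closed_segment p q = {}" "continuous_on (closed_segment p q) f"
  shows "(\<lambda>z. contour_integral (linepath p q) (\<lambda>w. f w / (w - z))) holomorphic_on S"
  unfolding holomorphic_on_open[OF assms(1)]
proof
    fix z assume z: "z \<in> S"
    have "((\<lambda>w. f w / (w - z) ^ 1) has_contour_integral
        contour_integral (linepath p q) (\<lambda>w. f w / (w - z))) (linepath p q)"
      if "z \<in> S - path_image (linepath p q)" for z
    proof -
      have "(\<lambda>w. f w / (w - z)) contour_integrable_on linepath p q"
        using that assms(3) by (intro contour_integrable_continuous_linepath continuous_intros) auto
      then show ?thesis using has_contour_integral_integral by simp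
    qed
    from Cauchy_next_derivative(2)[of "linepath p q" f "cmod (q - p)" S 1, OF _ _ this]
    show "\<exists>f'. ((\<lambda>z. contour_integral (linepath p q) (\<lambda>w. f w / (w - z))) has_field_derivative f') (at z)"
      using assms z by auto
qed

text \<open>Off the boundary an edge integral is the Cauchy integral of \<open>cnj\<close>, which is
  holomorphic, minus \<open>cnj z\<close> times the integral of \<open>1 / (w - z)\<close>. Round
  the whole boundary the latter integral is \<open>2 * of_real pi * \<i>\<close> by the winding
  number, which isolates \<open>cnj z\<close>.\<close>

lemma square_boundary_edges:
  assumes M: "M > 0"
  shows "\<exists>G. G holomorphic_on ball 0 M \<and> (\<forall>z\<in>ball 0 M.
    edge (Complex (-M) (-M)) (Complex M (-M)) z + edge (Complex M (-M)) (Complex M M) z +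
    edge (Complex M M) (Complex (-M) M) z + edge (Complex (-M) M) (Complex (-M) (-M)) z
    = G z - 2 * of_real pi * \<i> * cnj z)"
proof -
  let ?a = "Complex (-M) (-M)" and ?b = "Complex M (-M)" and ?c = "Complex M M" and ?d = "Complex (-M) M"
  have far: "M \<le> cmod w" if "w \<in> closed_segment ?a ?b \<union> closed_segment ?b ?c \<union> closed_segment ?c ?d \<union> closed_segment ?d ?a" for w
  proof -
    have "\<bar>Re w\<bar> = M \<or> \<bar>Im w\<bar> = M"
      using that M by (auto simp: closed_segment_same_Re closed_segment_same_Im)
    then show ?thesis
      using abs_Re_le_cmod[of w] abs_Im_le_cmod[of w] by auto
  qed
  have disj: "ball 0 M \<inter> closed_segment ?a ?b = {}" "ball 0 M \<inter> closed_segment ?b ?c = {}"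
    "ball 0 M \<inter> closed_segment ?c ?d = {}" "ball 0 M \<inter> closed_segment ?d ?a = {}"
    using far by fastforce+
  define C where "C = (\<lambda>p q z. contour_integral (linepath p q) (\<lambda>w. cnj w / (w - z)))"
  define K where "K = (\<lambda>p q z. contour_integral (linepath p q) (\<lambda>w. 1 / (w - z)))"
  have edge: "edge p q z = C p q z - cnj z * K p q z" if "ball 0 M \<inter> closed_segment p q = {}" "z \<in> ball 0 M" for p q z
    unfolding C_def K_def using edge_eq[of z p q] that by blast
  have K: "K ?a ?b z + K ?b ?c z + K ?c ?d z + K ?d ?a z = 2 * of_real pi * \<i>" if z: "z \<in> ball 0 M" for z
  proof -
    have "\<bar>Re z\<bar> < M" "\<bar>Im z\<bar> < M"
      using z abs_Re_le_cmod[of z] abs_Im_le_cmod[of z] by auto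
    then have "z \<in> box ?a ?c"
      by (auto simp: in_box_complex_iff)
    then have w: "winding_number (rectpath ?a ?c) z = 1"
      by (rule winding_number_rectpath)
    have rp: "rectpath ?a ?c = linepath ?a ?b +++ linepath ?b ?c +++ linepath ?c ?d +++ linepath ?d ?a"
      by (simp add: rectpath_def Let_def)
    have nz: "z \<notin> closed_segment ?a ?b" "z \<notin> closed_segment ?b ?c" "z \<notin> closed_segment ?c ?d" "z \<notin> closed_segment ?d ?a"
      using z disj by blast+
    have i: "(\<lambda>w. 1 / (w - z)) contour_integrable_on linepath p q" if "z \<notin> closed_segment p q" for p q
      using that by (intro contour_integrable_continuous_linepath continuous_intros) auto
    have "z \<notin> path_image (rectpath ?a ?c)"
      unfolding rp using nz by (simp add: path_image_join)
    then have "1 / (2 * of_real pi * \<i>) * contour_integral (rectpath ?a ?c) (\<lambda>w. 1 / (w - z)) = 1"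
      using winding_number_valid_path[of "rectpath ?a ?c" z] w by simp
    moreover have "((\<lambda>w. 1 / (w - z)) has_contour_integral (K ?a ?b z + (K ?b ?c z + (K ?c ?d z + K ?d ?a z)))) (rectpath ?a ?c)"
      unfolding rp K_def
      by (intro has_contour_integral_join has_contour_integral_integral i nz valid_path_join valid_path_linepath) simp_all
    then have "contour_integral (rectpath ?a ?c) (\<lambda>w. 1 / (w - z)) = K ?a ?b z + K ?b ?c z + K ?c ?d z + K ?d ?a z"
      by (simp add: contour_integral_unique add.assoc)
    ultimately show ?thesis by (simp add: field_simps)
  qed
  show ?thesis
  proof (intro exI[of _ "\<lambda>z. C ?a ?b z + C ?b ?c z + C ?c ?d z + C ?d ?a z"] conjI ballI)
    show "(\<lambda>z. C ?a ?b z + C ?b ?c z + C ?c ?d z + C ?d ?a z) holomorphic_on ball 0 M"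
      unfolding C_def
      by (intro holomorphic_intros holomorphic_linepath_cauchy_integral disj open_ball continuous_intros)
    fix z :: complex assume z: "z \<in> ball 0 M"
    have "edge ?a ?b z + edge ?b ?c z + edge ?c ?d z + edge ?d ?a z =
        (C ?a ?b z + C ?b ?c z + C ?c ?d z + C ?d ?a z)
        - cnj z * (K ?a ?b z + K ?b ?c z + K ?c ?d z + K ?d ?a z)"
      unfolding edge[OF disj(1) z] edge[OF disj(2) z] edge[OF disj(3) z] edge[OF disj(4) z]
      by (simp add: algebra_simps)
    then show "edge ?a ?b z + edge ?b ?c z + edge ?c ?d z + edge ?d ?a z =
        C ?a ?b z + C ?b ?c z + C ?c ?d z + C ?d ?a z - 2 * of_real pi * \<i> * cnj z"
      unfolding K[OF z] by (simp add: mult_ac)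
  qed
qed

section \<open>Summation over the grid\<close>

definition grid :: "real \<Rightarrow> nat \<Rightarrow> nat \<Rightarrow> nat \<Rightarrow> complex" where
  "grid M n i j = Complex (- M + 2 * M * real i / real n) (- M + 2 * M * real j / real n)"

text \<open>Each inner edge occurs twice with opposite orientation, for any position of
  \<open>z\<close>, so vertical edges telescope in \<open>i\<close> and horizontal ones in
  \<open>j\<close>. The four outer sides are reassembled from their pieces, and \<open>z\<close> is
  off those.\<close>

lemma grid_square_sums:
  assumes M: "M > 0" and n: "n > 0" and z: "cmod z < M"
  shows "(\<Sum>i<n. \<Sum>j<n. square_sum (\<lambda>p q. edge p q z) (grid M n i j) (2 * M / real n)) =
    edge (Complex (-M) (-M)) (Complex M (-M)) z + edge (Complex M (-M)) (Complex M M) z +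
    edge (Complex M M) (Complex (-M) M) z + edge (Complex (-M) M) (Complex (-M) (-M)) z"
proof -
  let ?c = "grid M n"
  define h where "h = (\<lambda>i j. edge (?c i j) (?c (Suc i) j) z)"
  define v where "v = (\<lambda>i j. edge (?c i j) (?c i (Suc j)) z)"
  have step: "?c i j + of_real (2 * M / n) = ?c (Suc i) j" "?c i j + \<i> * of_real (2 * M / n) = ?c i (Suc j)"
    "?c i j + of_real (2 * M / n) + \<i> * of_real (2 * M / n) = ?c (Suc i) (Suc j)" for i j
    by (auto simp: grid_def complex_eq_iff add_divide_distrib distrib_left)
  have sq: "square_sum (\<lambda>p q. edge p q z) (?c i j) (2 * M / n) = (v (Suc i) j - v i j) - (h i (Suc j) - h i j)" for i j
    unfolding square_sum_def step h_def v_def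
    by (simp add: edge_reverse[of "?c i (Suc j)" "?c (Suc i) (Suc j)"] edge_reverse[of "?c i j" "?c i (Suc j)"])
  have "(\<Sum>i<n. \<Sum>j<n. square_sum (\<lambda>p q. edge p q z) (?c i j) (2 * M / n)) =
      (\<Sum>j<n. \<Sum>i<n. v (Suc i) j - v i j) - (\<Sum>i<n. \<Sum>j<n. h i (Suc j) - h i j)"
    unfolding sq sum_subtractf by (subst (2 4) sum.swap) simp
  also have "\<dots> = (\<Sum>j<n. v n j - v 0 j) - (\<Sum>i<n. h i n - h i 0)"
    using sum_lessThan_telescope[of "\<lambda>i. v i j" n for j] sum_lessThan_telescope[of "h i" n for i] by simp
  also have "\<dots> = (\<Sum>j<n. v n j) - (\<Sum>j<n. v 0 j) - ((\<Sum>i<n. h i n) - (\<Sum>i<n. h i 0))"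
    by (simp only: sum_subtractf)
  also have "(\<Sum>j<n. v n j) = edge (Complex M (-M)) (Complex M M) z"
  proof -
    have "z \<notin> closed_segment (Complex M (-M)) (Complex M M)"
      using z abs_Re_le_cmod[of z] M by (auto simp: closed_segment_same_Re)
    moreover have "grid M n n i = Complex M (-M) + of_real (real i / real n) * (Complex M M - Complex M (-M))" for i
      using n by (simp add: grid_def complex_eq_iff field_simps)
    ultimately show ?thesis
      using edge_subdivide[OF _ n] by (simp only: v_def)
  qed
  also have "(\<Sum>j<n. v 0 j) = edge (Complex (-M) (-M)) (Complex (-M) M) z"
  proof -
    have "z \<notin> closed_segment (Complex (-M) (-M)) (Complex (-M) M)"
      using z abs_Re_le_cmod[of z] M by (auto simp: closed_segment_same_Re)
    moreover have "grid M n 0 i = Complex (-M) (-M) + of_real (real i / real n) * (Complex (-M) M - Complex (-M) (-M))" for i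
      using n by (simp add: grid_def complex_eq_iff field_simps)
    ultimately show ?thesis
      using edge_subdivide[OF _ n] by (simp only: v_def)
  qed
  also have "(\<Sum>i<n. h i n) = edge (Complex (-M) M) (Complex M M) z"
  proof -
    have "z \<notin> closed_segment (Complex (-M) M) (Complex M M)"
      using z abs_Im_le_cmod[of z] M by (auto simp: closed_segment_same_Im)
    moreover have "grid M n i n = Complex (-M) M + of_real (real i / real n) * (Complex M M - Complex (-M) M)" for i
      using n by (simp add: grid_def complex_eq_iff field_simps)
    ultimately show ?thesis
      using edge_subdivide[OF _ n] by (simp only: h_def)
  qed
  also have "(\<Sum>i<n. h i 0) = edge (Complex (-M) (-M)) (Complex M (-M)) z"
  proof -
    have "z \<notin> closed_segment (Complex (-M) (-M)) (Complex M (-M))"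
      using z abs_Im_le_cmod[of z] M by (auto simp: closed_segment_same_Im)
    moreover have "grid M n i 0 = Complex (-M) (-M) + of_real (real i / real n) * (Complex M (-M) - Complex (-M) (-M))" for i
      using n by (simp add: grid_def complex_eq_iff field_simps)
    ultimately show ?thesis
      using edge_subdivide[OF _ n] by (simp only: h_def)
  qed
  finally show ?thesis
    by (simp add: edge_reverse[of "Complex (-M) (-M)" "Complex (-M) M"] edge_reverse[of "Complex (-M) M" "Complex M M"])
qed

text \<open>Split at the integer part \<open>k\<close> of \<open>x\<close>: to the left
  \<open>1 + |x - i|\<close> is at least \<open>k - i + 1\<close>, to the right at least
  \<open>i - k\<close>. Each side is dominated by a harmonic sum.\<close>

lemma sum_inverse_dist_le_harm:
  fixes x :: real
  assumes "0 \<le> x" "x < real n"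
  shows "(\<Sum>i<n. 1 / (1 + \<bar>x - real i\<bar>)) \<le> 2 * harm n"
proof -
  define k where "k = nat \<lfloor>x\<rfloor>"
  have k: "real k \<le> x" "x < real k + 1" "k < n"
    using assms unfolding k_def by linarith+
  have "(\<Sum>i<n. 1 / (1 + \<bar>x - real i\<bar>)) =
      (\<Sum>i<Suc k. 1 / (1 + \<bar>x - real i\<bar>)) + (\<Sum>i\<in>{Suc k..<n}. 1 / (1 + \<bar>x - real i\<bar>))"
    using k(3) by (subst sum.union_disjoint[symmetric]) (auto intro!: sum.cong)
  also have "(\<Sum>i<Suc k. 1 / (1 + \<bar>x - real i\<bar>)) \<le> (\<Sum>i<Suc k. inverse (real (Suc (k - i))))"
    by (intro sum_mono) (use k in \<open>auto simp: divide_simps of_nat_diff\<close>)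
  also have "(\<Sum>i<Suc k. inverse (real (Suc (k - i)))) = (\<Sum>i<Suc k. inverse (real (Suc i)))"
    using sum.nat_diff_reindex[of "\<lambda>i. inverse (real (Suc i))" "Suc k"] by simp
  also have "\<dots> = harm (Suc k)"
    by (simp add: harm_def sum.atLeast1_atMost_eq)
  also have "\<dots> \<le> harm n"
    using k(3) by (intro harm_mono) auto
  also have "(\<Sum>i\<in>{Suc k..<n}. 1 / (1 + \<bar>x - real i\<bar>)) \<le> (\<Sum>i\<in>{Suc k..<n}. inverse (real (i - k)))"
    by (intro sum_mono) (use k in \<open>auto simp: divide_simps of_nat_diff\<close>)
  also have "\<dots> = (\<Sum>i\<in>{1..<n - k}. inverse (real i))"
    by (rule sum.reindex_bij_witness[of _ "\<lambda>i. i + k" "\<lambda>i. i - k"]) auto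
  also have "\<dots> \<le> harm n"
    unfolding harm_def by (intro sum_mono2) auto
  finally show ?thesis by simp
qed

text \<open>\<open>harm n - ln n\<close> converges, so \<open>harm n / sqrt n\<close> is a
  convergent factor times \<open>1 / sqrt n\<close>, plus \<open>ln n / sqrt n\<close>; both terms
  tend to 0.\<close>

lemma harm_squared_over_n_tendsto: "(\<lambda>n. (harm n)\<^sup>2 / real n) \<longlonglongrightarrow> 0"
proof -
  have conv: "(\<lambda>n. harm n - ln (real n)) \<longlonglongrightarrow> euler_mascheroni"
    by (rule euler_mascheroni_LIMSEQ)
  have "(\<lambda>n. 1 / sqrt (real n)) \<longlonglongrightarrow> 0"
    using tendsto_inverse_0_at_top[OF filterlim_compose[OF sqrt_at_top filterlim_real_sequentially]]
    by (simp add: inverse_eq_divide)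
  moreover have "(\<lambda>n. ln (real n) / sqrt (real n)) \<longlonglongrightarrow> 0"
    using lim_ln_over_power[of "1/2"] by (simp add: powr_half_sqrt)
  ultimately have "(\<lambda>n. ((harm n - ln (real n)) * (1 / sqrt (real n)) + ln (real n) / sqrt (real n))\<^sup>2)
      \<longlonglongrightarrow> (euler_mascheroni * 0 + 0)\<^sup>2"
    by (intro tendsto_intros conv)
  moreover have "((harm n - ln (real n)) * (1 / sqrt (real n)) + ln (real n) / sqrt (real n))\<^sup>2 = (harm n)\<^sup>2 / real n" for n
    by (simp add: diff_divide_distrib power_divide)
  ultimately have "(\<lambda>n. (harm n)\<^sup>2 / real n) \<longlonglongrightarrow> (euler_mascheroni * 0 + 0)\<^sup>2"
    by (simp only:)
  then show ?thesis by simp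
qed

lemma poly_approx_cnj:
  assumes X: "compact X" "connected (- X)" "interior X = {}"
  shows "poly_approx X cnj"
proof -
  obtain B where "B > 0" "\<And>z. z \<in> X \<Longrightarrow> cmod z \<le> B"
    using compact_imp_bounded[OF X(1)] unfolding bounded_pos by blast
  \<comment> \<open>\<open>X\<close> lies in the disc of half the radius \<open>M\<close>, which
    leaves room for the Taylor series of \<open>G\<close>, holomorphic on \<open>ball 0 M\<close>,
    to converge uniformly on \<open>X\<close>.\<close>
  then obtain M where M: "M > 0" "\<And>z. z \<in> X \<Longrightarrow> cmod z \<le> M / 2"
    by (intro that[of "2 * B"]) auto
  obtain G where G: "G holomorphic_on ball 0 M" "\<And>z. z \<in> ball 0 M \<Longrightarrow>
    edge (Complex (-M) (-M)) (Complex M (-M)) z + edge (Complex M (-M)) (Complex M M) z +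
    edge (Complex M M) (Complex (-M) M) z + edge (Complex (-M) M) (Complex (-M) (-M)) z
    = G z - 2 * of_real pi * \<i> * cnj z"
    using square_boundary_edges[OF M(1)] by blast
  have Gp: "poly_approx X G"
    using poly_approx_holomorphic_compose[OF X(1) poly_approx_ident G(1), of "M / 2"] M by simp
  show ?thesis
  proof (rule poly_approx_closed)
    fix e :: real assume e: "e > 0"
    \<comment> \<open>The final bound: \<open>168400 * d\<close> with \<open>d = 2 * M / n\<close>,
      times \<open>(2 * harm n)\<^sup>2\<close>.\<close>
    have "(\<lambda>n. 168400 * (2 * M) * 4 * ((harm n)\<^sup>2 / real n)) \<longlonglongrightarrow> 168400 * (2 * M) * 4 * 0"
      by (intro tendsto_intros harm_squared_over_n_tendsto)
    then have "eventually (\<lambda>n. 168400 * (2 * M) * 4 * ((harm n)\<^sup>2 / real n) < e) sequentially"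
      using e by (intro order_tendstoD) auto
    then have "eventually (\<lambda>n. n > 0 \<and> 168400 * (2 * M) * 4 * ((harm n)\<^sup>2 / real n) < e) sequentially"
      by (intro eventually_conj eventually_gt_at_top)
    from eventually_happens'[OF sequentially_bot this]
    obtain n :: nat where n: "n > 0" "168400 * (2 * M) * 4 * ((harm n)\<^sup>2 / real n) < e"
      by blast
    define d where "d = 2 * M / real n"
    have d: "d > 0" using M n by (simp add: d_def)
    let ?S = "\<lambda>i j z. square_sum (\<lambda>p q. edge p q z) (grid M n i j) d"
    obtain H' where H': "\<forall>c. poly_approx X (H' c) \<and> (\<forall>z\<in>X.
        cmod (square_sum (\<lambda>p q. edge p q z) c d - H' c z) \<le> 168400 * d / (1 + cmod (z - c) / d)\<^sup>2)"
      using choice[OF allI[OF square_piece_approx[OF X d]]] ..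
    define H where "H = (\<lambda>i j. H' (grid M n i j))"
    have H: "poly_approx X (H i j)"
      "z \<in> X \<Longrightarrow> cmod (?S i j z - H i j z) \<le> 168400 * d / (1 + cmod (z - grid M n i j) / d)\<^sup>2" for i j z
      using H' by (simp_all add: H_def)
    define g where "g = (\<lambda>z. (1 / (2 * of_real pi * \<i>)) * (G z - (\<Sum>i<n. \<Sum>j<n. H i j z)))"
    have "poly_approx X g"
      unfolding g_def by (intro poly_approx_mult poly_approx_diff poly_approx_const poly_approx_sum X Gp H)
    moreover have "cmod (cnj z - g z) < e" if z: "z \<in> X" for z
    proof -
      have zM: "cmod z < M" using M z by fastforce
      then have tot: "(\<Sum>i<n. \<Sum>j<n. ?S i j z) = G z - 2 * of_real pi * \<i> * cnj z"
        using grid_square_sums[OF M(1) n(1) zM] G(2)[of z] by (simp add: d_def)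
      have "cnj z - g z = (1 / (2 * of_real pi * \<i>)) * (2 * of_real pi * \<i> * cnj z - (G z - (\<Sum>i<n. \<Sum>j<n. H i j z)))"
        unfolding g_def by (simp add: field_simps)
      also have "2 * of_real pi * \<i> * cnj z - (G z - (\<Sum>i<n. \<Sum>j<n. H i j z)) = - (\<Sum>i<n. \<Sum>j<n. ?S i j z - H i j z)"
        unfolding sum_subtractf tot by simp
      finally have "cmod (cnj z - g z) = cmod (\<Sum>i<n. \<Sum>j<n. ?S i j z - H i j z) / (2 * pi)"
        by (simp add: norm_mult norm_divide)
      also have "\<dots> \<le> cmod (\<Sum>i<n. \<Sum>j<n. ?S i j z - H i j z) / 1"
        using pi_gt3 by (intro divide_left_mono) auto
      also have "\<dots> \<le> (\<Sum>i<n. \<Sum>j<n. cmod (?S i j z - H i j z))"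
        by (simp, rule order_trans[OF norm_sum sum_mono[OF norm_sum]])
      \<comment> \<open>The square of the distance is weakened to the product of the two coordinate
        distances. The double sum then factors into two single sums, at the price of a second
        logarithm.\<close>
      also have "\<dots> \<le> (\<Sum>i<n. \<Sum>j<n. 168400 * d *
          ((1 / (1 + \<bar>(Re z + M) / d - real i\<bar>)) * (1 / (1 + \<bar>(Im z + M) / d - real j\<bar>))))"
      proof (intro sum_mono order_trans[OF H(2)[OF z]])
        fix i j
        let ?t = "cmod (z - grid M n i j) / d"
        have "(Re z + M) / d - real i = Re (z - grid M n i j) / d" "(Im z + M) / d - real j = Im (z - grid M n i j) / d"
          using M n by (simp_all add: grid_def d_def field_simps)
        then have "\<bar>(Re z + M) / d - real i\<bar> \<le> ?t" "\<bar>(Im z + M) / d - real j\<bar> \<le> ?t"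
          using d abs_Re_le_cmod[of "z - grid M n i j"] abs_Im_le_cmod[of "z - grid M n i j"]
          by (simp_all add: divide_right_mono)
        then have "(1 + \<bar>(Re z + M) / d - real i\<bar>) * (1 + \<bar>(Im z + M) / d - real j\<bar>) \<le> (1 + ?t)\<^sup>2"
          unfolding power2_eq_square by (intro mult_mono) auto
        then have "168400 * d / (1 + ?t)\<^sup>2 \<le>
            168400 * d / ((1 + \<bar>(Re z + M) / d - real i\<bar>) * (1 + \<bar>(Im z + M) / d - real j\<bar>))"
          using d by (intro divide_left_mono mult_pos_pos zero_less_power add_pos_nonneg) auto
        then show "168400 * d / (1 + ?t)\<^sup>2 \<le> 168400 * d *
            ((1 / (1 + \<bar>(Re z + M) / d - real i\<bar>)) * (1 / (1 + \<bar>(Im z + M) / d - real j\<bar>)))"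
          by simp
      qed
      also have "\<dots> = 168400 * d * ((\<Sum>i<n. 1 / (1 + \<bar>(Re z + M) / d - real i\<bar>)) *
          (\<Sum>j<n. 1 / (1 + \<bar>(Im z + M) / d - real j\<bar>)))"
        unfolding sum_product by (simp only: sum_distrib_left)
      also have "\<dots> \<le> 168400 * d * ((2 * harm n) * (2 * harm n))"
      proof -
        have "\<bar>Re z\<bar> < M" "\<bar>Im z\<bar> < M"
          using zM abs_Re_le_cmod[of z] abs_Im_le_cmod[of z] by auto
        then have "0 \<le> (Re z + M) / d" "(Re z + M) / d < real n" "0 \<le> (Im z + M) / d" "(Im z + M) / d < real n"
          using d n by (auto simp: d_def divide_simps)
        then show ?thesis
          using d by (intro mult_left_mono mult_mono sum_inverse_dist_le_harm sum_nonneg) (auto simp: harm_nonneg)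
      qed
      also have "\<dots> = 168400 * (2 * M) * 4 * ((harm n)\<^sup>2 / real n)"
        by (simp add: d_def power2_eq_square)
      finally show ?thesis using n(2) by linarith
    qed
    ultimately show "\<exists>g. poly_approx X g \<and> (\<forall>z\<in>X. cmod (cnj z - g z) < e)"
      by blast
  qed
qed

theorem Lavrentiev:
  assumes X: "compact X" "connected (- X)" "interior X = {}" and f: "continuous_on X f"
  shows "poly_approx X f"
proof -
  have z: "z = of_real (Re z) + \<i> * of_real (Im z)" "of_real (Re z) = (1 / 2) * (z + cnj z)"
      "of_real (Im z) = (1 / (2 * \<i>)) * (z - cnj z)" for z
    by (auto simp: complex_eq_iff)
  have ReIm: "poly_approx X (\<lambda>z. of_real (Re z))" "poly_approx X (\<lambda>z. of_real (Im z))"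
    unfolding z(2,3)
    by (intro poly_approx_mult poly_approx_add poly_approx_diff poly_approx_const poly_approx_ident
        poly_approx_cnj X)+
  have rpf: "poly_approx X (\<lambda>z. of_real (g z))" if "real_polynomial_function g" for g
    using that
  proof (induction g rule: real_polynomial_function.induct)
    case (linear g)
    interpret bounded_linear g by fact
    have "g z = Re z * g 1 + Im z * g \<i>" for z
    proof -
      have "z = Re z *\<^sub>R 1 + Im z *\<^sub>R \<i>" by (simp add: complex_eq_iff)
      then have "g z = g (Re z *\<^sub>R 1 + Im z *\<^sub>R \<i>)" by (rule arg_cong)
      then show ?thesis by (simp only: add scaleR) simp
    qed
    note g_eq = this
    have "poly_approx X (\<lambda>z. of_real (Re z) * of_real (g 1) + of_real (Im z) * of_real (g \<i>))"
      by (intro poly_approx_add poly_approx_mult poly_approx_const ReIm X)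
    then show ?case
      by (rule poly_approx_cong) (subst g_eq, simp only: of_real_add of_real_mult)
  qed (auto intro!: poly_approx_const poly_approx_add poly_approx_mult X)
  have real: "poly_approx X (\<lambda>z. of_real (g z))" if g: "continuous_on X g" for g :: "complex \<Rightarrow> real"
  proof (rule poly_approx_closed)
    fix e :: real assume "e > 0"
    then obtain h where "real_polynomial_function h" "\<And>x. x \<in> X \<Longrightarrow> \<bar>g x - h x\<bar> < e"
      using Stone_Weierstrass_real_polynomial_function[OF X(1) g \<open>e > 0\<close>] by blast
    then show "\<exists>h. poly_approx X h \<and> (\<forall>z\<in>X. cmod (of_real (g z) - h z) < e)"
      by (intro exI[of _ "\<lambda>z. of_real (h z)"]) (auto simp: rpf simp flip: of_real_diff)
  qed
  have "poly_approx X (\<lambda>w. of_real (Re (f w)) + \<i> * of_real (Im (f w)))"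
    by (intro poly_approx_add poly_approx_mult poly_approx_const real continuous_intros f X)
  then show ?thesis
    by (rule poly_approx_cong) (rule z(1)[symmetric])
qed

section \<open>Variation and path integrals\<close>

text \<open>Curried so that \<open>variation \<gamma> a\<close> is a function of the right end
  point, whose increments telescope over a division.\<close>

definition variation :: "(real \<Rightarrow> complex) \<Rightarrow> real \<Rightarrow> real \<Rightarrow> real" where
  "variation \<gamma> a b = cpath_length (a, b, \<gamma>)"

abbreviation var_sum :: "(real \<Rightarrow> complex) \<Rightarrow> real set set \<Rightarrow> real" where
  "var_sum \<gamma> d \<equiv> (\<Sum>k\<in>d. cmod (\<gamma> (Sup k) - \<gamma> (Inf k)))"

lemma variation_sums_eq: "variation_sums (a, b, \<gamma>) = {var_sum \<gamma> d | d. d division_of {a..b}}"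
  by (simp add: variation_sums_def)

lemma var_sum_le_variation:
  assumes "rectifiable (a, b, \<gamma>)" "d division_of {a..b}"
  shows "var_sum \<gamma> d \<le> variation \<gamma> a b"
  using assms unfolding variation_def cpath_length_def rectifiable_def
  by (intro cSup_upper) (auto simp: variation_sums_eq)

lemma variation_le:
  assumes "\<And>d. d division_of {a..b} \<Longrightarrow> var_sum \<gamma> d \<le> C"
  shows "variation \<gamma> a b \<le> C"
proof -
  have "\<exists>d. d division_of {a..b}"
    using elementary_interval[of a b] by auto
  then show ?thesis
    unfolding variation_def cpath_length_def
    by (intro cSup_least) (auto simp: variation_sums_eq intro: assms)
qed

lemma norm_diff_le_variation:
  assumes "rectifiable (a, b, \<gamma>)" "a \<le> b"
  shows "cmod (\<gamma> b - \<gamma> a) \<le> variation \<gamma> a b"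
proof -
  have "{{a..b}} division_of {a..b}"
    using assms(2) division_of_self[of a b] by simp
  from var_sum_le_variation[OF assms(1) this] show ?thesis
    using assms(2) by simp
qed

lemma division_of_append:
  fixes a s b :: real
  assumes "a \<le> s" "s \<le> b" "d1 division_of {a..s}" "d2 division_of {s..b}"
  shows "d1 \<union> d2 division_of {a..b}" "var_sum \<gamma> (d1 \<union> d2) = var_sum \<gamma> d1 + var_sum \<gamma> d2"
proof -
  have ab: "{a..s} \<union> {s..b} = {a..b}" using assms by auto
  have "interior {a..s} \<inter> interior {s..b} = {}"
    by (simp add: interior_atLeastAtMost_real)
  then show "d1 \<union> d2 division_of {a..b}"
    using division_disjoint_union[OF assms(3,4)] ab by simp
  show "var_sum \<gamma> (d1 \<union> d2) = var_sum \<gamma> d1 + var_sum \<gamma> d2"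
  proof (rule sum.union_inter_neutral)
    show "finite d1" "finite d2"
      using assms(3,4) by (auto dest: division_of_finite)
    \<comment> \<open>The divisions need not be disjoint: both may contain the degenerate interval
      \<open>{s}\<close>, whose chord is 0.\<close>
    show "\<forall>k\<in>d1 \<inter> d2. cmod (\<gamma> (Sup k) - \<gamma> (Inf k)) = 0"
    proof
      fix k assume k: "k \<in> d1 \<inter> d2"
      then have "k \<subseteq> {a..s}" "k \<subseteq> {s..b}" "k \<noteq> {}"
        using division_ofD(2,3)[OF assms(3)] division_ofD(2)[OF assms(4)] by blast+
      then have "k = {s}" by fastforce
      then show "cmod (\<gamma> (Sup k) - \<gamma> (Inf k)) = 0" by simp
    qed
  qed
qed

text \<open>Divisions of adjacent intervals concatenate; taking suprema over the two pieces in turn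
  gives superadditivity. It is the direction that bounds chords by increments of
  \<open>variation \<gamma> a\<close>.\<close>

lemma rectifiable_variation_subinterval:
  assumes rect: "rectifiable (a, b, \<gamma>)" and st: "a \<le> s" "s \<le> t" "t \<le> b"
  shows "rectifiable (s, t, \<gamma>)" "variation \<gamma> a s + variation \<gamma> s t \<le> variation \<gamma> a t"
    "variation \<gamma> a t \<le> variation \<gamma> a b"
proof -
  have triv: "{{u..v}} division_of {u..v}" if "u \<le> v" for u v :: real
    using that division_of_self[of u v] by simp
  have right: "rectifiable (u, v, \<gamma>)" if "rectifiable (u, w, \<gamma>)" "u \<le> v" "v \<le> w" for u v w
    unfolding rectifiable_def
  proof (rule bdd_aboveI)
    fix x assume "x \<in> variation_sums (u, v, \<gamma>)"
    then obtain d where d: "d division_of {u..v}" "x = var_sum \<gamma> d"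
      by (auto simp: variation_sums_eq)
    have "x \<le> var_sum \<gamma> (d \<union> {{v..w}})"
      using division_of_append(2)[OF that(2,3) d(1) triv[OF that(3)]] d(2) by simp
    also have "\<dots> \<le> variation \<gamma> u w"
      by (intro var_sum_le_variation that division_of_append(1)[OF that(2,3)] d triv)
    finally show "x \<le> variation \<gamma> u w" .
  qed
  have left: "rectifiable (v, w, \<gamma>)" if "rectifiable (u, w, \<gamma>)" "u \<le> v" "v \<le> w" for u v w
    unfolding rectifiable_def
  proof (rule bdd_aboveI)
    fix x assume "x \<in> variation_sums (v, w, \<gamma>)"
    then obtain d where d: "d division_of {v..w}" "x = var_sum \<gamma> d"
      by (auto simp: variation_sums_eq)
    have "x \<le> var_sum \<gamma> ({{u..v}} \<union> d)"
      using division_of_append(2)[OF that(2,3) triv[OF that(2)] d(1)] d(2) by simp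
    also have "\<dots> \<le> variation \<gamma> u w"
      by (intro var_sum_le_variation that division_of_append(1)[OF that(2,3)] d triv)
    finally show "x \<le> variation \<gamma> u w" .
  qed
  have super: "variation \<gamma> u v + variation \<gamma> v w \<le> variation \<gamma> u w"
    if "rectifiable (u, w, \<gamma>)" "u \<le> v" "v \<le> w" for u v w
  proof -
    have "variation \<gamma> u v \<le> variation \<gamma> u w - variation \<gamma> v w"
    proof (rule variation_le)
      fix d1 assume d1: "d1 division_of {u..v}"
      have "variation \<gamma> v w \<le> variation \<gamma> u w - var_sum \<gamma> d1"
      proof (rule variation_le)
        fix d2 assume d2: "d2 division_of {v..w}"
        show "var_sum \<gamma> d2 \<le> variation \<gamma> u w - var_sum \<gamma> d1"
          using var_sum_le_variation[OF that(1) division_of_append(1)[OF that(2,3) d1 d2]]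
            division_of_append(2)[OF that(2,3) d1 d2, of \<gamma>] by linarith
      qed
      then show "var_sum \<gamma> d1 \<le> variation \<gamma> u w - variation \<gamma> v w" by linarith
    qed
    then show ?thesis by linarith
  qed
  have at: "rectifiable (a, t, \<gamma>)" by (rule right[OF rect]) (use st in auto)
  show "rectifiable (s, t, \<gamma>)" by (rule left[OF at]) (use st in auto)
  show "variation \<gamma> a s + variation \<gamma> s t \<le> variation \<gamma> a t"
    by (rule super[OF at]) (use st in auto)
  have "0 \<le> variation \<gamma> t b"
    by (rule order_trans[OF norm_ge_zero norm_diff_le_variation[OF left[OF rect]]]) (use st in auto)
  moreover have "variation \<gamma> a t + variation \<gamma> t b \<le> variation \<gamma> a b"
    by (rule super[OF rect]) (use st in auto)
  ultimately show "variation \<gamma> a t \<le> variation \<gamma> a b" by linarith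
qed

lemma norm_diff_le_variation_diff:
  assumes "rectifiable (a, b, \<gamma>)" "a \<le> s" "s \<le> t" "t \<le> b"
  shows "cmod (\<gamma> t - \<gamma> s) \<le> variation \<gamma> a t - variation \<gamma> a s"
  using rectifiable_variation_subinterval(1,2)[OF assms] norm_diff_le_variation[of s t \<gamma>] assms by linarith

lemma variation_nonneg:
  assumes "rectifiable (a, b, \<gamma>)" "a \<le> b"
  shows "0 \<le> variation \<gamma> a b"
  using norm_diff_le_variation[OF assms] norm_ge_zero order_trans by blast

section \<open>Riemann-Stieltjes sums over tagged divisions\<close>

lemma tagged_division_interval:
  fixes a b :: real
  assumes "p tagged_division_of {a..b}" "(x, k) \<in> p"
  shows "Inf k \<in> k" "Sup k \<in> k" "a \<le> Inf k" "Inf k \<le> x" "x \<le> Sup k" "Sup k \<le> b"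
proof -
  obtain u v where k: "k = {u..v}"
    using tagged_division_ofD(4)[OF assms] by auto
  have "x \<in> k" "k \<subseteq> {a..b}"
    using tagged_division_ofD(2,3)[OF assms] by auto
  then show "Inf k \<in> k" "Sup k \<in> k" "a \<le> Inf k" "Inf k \<le> x" "x \<le> Sup k" "Sup k \<le> b"
    using k by auto
qed

text \<open>The increments of \<open>variation \<gamma> a\<close> telescope, so an estimate on each
  tagged interval, relative to the variation there, becomes one for the whole sum.\<close>

lemma tagged_variation_sum_le:
  assumes rect: "rectifiable (a, b, \<gamma>)" "a \<le> b" and p: "p tagged_division_of {a..b}" and "0 \<le> e"
    and F: "\<And>x k. (x, k) \<in> p \<Longrightarrow> cmod (F x k) \<le> e * (variation \<gamma> a (Sup k) - variation \<gamma> a (Inf k))"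
  shows "cmod (\<Sum>(x, k)\<in>p. F x k) \<le> e * variation \<gamma> a b"
proof -
  have "cmod (\<Sum>(x, k)\<in>p. F x k) \<le> (\<Sum>(x, k)\<in>p. e * (variation \<gamma> a (Sup k) - variation \<gamma> a (Inf k)))"
    by (rule sum_norm_le) (use F in auto)
  also have "\<dots> = e * (\<Sum>(x, k)\<in>p. variation \<gamma> a (Sup k) - variation \<gamma> a (Inf k))"
    by (simp add: sum_distrib_left case_prod_unfold)
  also have "\<dots> = e * (variation \<gamma> a b - variation \<gamma> a a)"
    by (simp only: additive_tagged_division_1[OF rect(2) p])
  also have "\<dots> \<le> e * variation \<gamma> a b"
    using variation_nonneg[OF rectifiable_variation_subinterval(1)[OF rect(1), of a a]] rect(2) \<open>0 \<le> e\<close>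
    by (intro mult_left_mono) auto
  finally show ?thesis .
qed

text \<open>The definition of the integral speaks of all fine tagged divisions; an upper bound for
  the integral needs one to exist.\<close>

lemma tagged_division_fine_exists:
  fixes a b :: real
  assumes "\<delta> > 0"
  obtains p where "p tagged_division_of {a..b}" "\<forall>(x, k)\<in>p. Sup k - Inf k < \<delta>"
proof -
  obtain p where p: "p tagged_division_of {a..b}" "(\<lambda>x. ball x (\<delta> / 2)) fine p"
    using fine_division_exists_real[OF gauge_ball[of "\<delta> / 2"]] assms by (metis half_gt_zero)
  have "Sup k - Inf k < \<delta>" if "(x, k) \<in> p" for x k
  proof -
    note i = tagged_division_interval[OF p(1) that]
    have "k \<subseteq> ball x (\<delta> / 2)" using p(2) that by (auto simp: fine_def)
    then have "Inf k \<in> ball x (\<delta> / 2)" "Sup k \<in> ball x (\<delta> / 2)" using i(1,2) by blast+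
    then show ?thesis unfolding mem_ball dist_real_def by linarith
  qed
  then show ?thesis using p(1) by (intro that[of p]) auto
qed

lemma has_path_integral_cong:
  assumes "\<And>t. t \<in> {a..b} \<Longrightarrow> \<gamma> t = \<gamma>' t"
  shows "has_path_integral g I (a, b, \<gamma>) \<longleftrightarrow> has_path_integral g I (a, b, \<gamma>')"
proof -
  have "(\<Sum>(x, k)\<in>p. g (\<gamma> x) * (\<gamma> (Sup k) - \<gamma> (Inf k))) = (\<Sum>(x, k)\<in>p. g (\<gamma>' x) * (\<gamma>' (Sup k) - \<gamma>' (Inf k)))"
    if p: "p tagged_division_of {a..b}" for p
  proof (rule sum.cong)
    fix y assume y: "y \<in> p"
    obtain x k where xk: "y = (x, k)" by force
    then show "(case y of (x, k) \<Rightarrow> g (\<gamma> x) * (\<gamma> (Sup k) - \<gamma> (Inf k))) =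
        (case y of (x, k) \<Rightarrow> g (\<gamma>' x) * (\<gamma>' (Sup k) - \<gamma>' (Inf k)))"
      using tagged_division_interval[OF p y[unfolded xk]] assms by auto
  qed auto
  then show ?thesis
    unfolding has_path_integral_def by simp
qed

lemma has_path_integral_diff:
  assumes "has_path_integral g I (a, b, \<gamma>)" "has_path_integral h J (a, b, \<gamma>)"
  shows "has_path_integral (\<lambda>z. g z - h z) (I - J) (a, b, \<gamma>)"
  unfolding has_path_integral_def split
proof (intro allI impI)
  fix e :: real assume "e > 0"
  obtain \<delta>1 where 1: "\<delta>1 > 0" "\<And>p. p tagged_division_of {a..b} \<Longrightarrow> (\<forall>(x, k)\<in>p. Sup k - Inf k < \<delta>1) \<Longrightarrow>
      cmod ((\<Sum>(x, k)\<in>p. g (\<gamma> x) * (\<gamma> (Sup k) - \<gamma> (Inf k))) - I) < e / 2"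
    using assms(1) half_gt_zero[OF \<open>e > 0\<close>] unfolding has_path_integral_def split by meson
  obtain \<delta>2 where 2: "\<delta>2 > 0" "\<And>p. p tagged_division_of {a..b} \<Longrightarrow> (\<forall>(x, k)\<in>p. Sup k - Inf k < \<delta>2) \<Longrightarrow>
      cmod ((\<Sum>(x, k)\<in>p. h (\<gamma> x) * (\<gamma> (Sup k) - \<gamma> (Inf k))) - J) < e / 2"
    using assms(2) half_gt_zero[OF \<open>e > 0\<close>] unfolding has_path_integral_def split by meson
  show "\<exists>\<delta>>0. \<forall>p. p tagged_division_of {a..b} \<and> (\<forall>(x, k)\<in>p. Sup k - Inf k < \<delta>) \<longrightarrow>
      cmod ((\<Sum>(x, k)\<in>p. (g (\<gamma> x) - h (\<gamma> x)) * (\<gamma> (Sup k) - \<gamma> (Inf k))) - (I - J)) < e"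
  proof (intro exI[of _ "min \<delta>1 \<delta>2"] conjI allI impI)
    show "0 < min \<delta>1 \<delta>2" using 1 2 by simp
    fix p assume p: "p tagged_division_of {a..b} \<and> (\<forall>(x, k)\<in>p. Sup k - Inf k < min \<delta>1 \<delta>2)"
    have "(\<Sum>(x, k)\<in>p. (g (\<gamma> x) - h (\<gamma> x)) * (\<gamma> (Sup k) - \<gamma> (Inf k))) - (I - J) =
       ((\<Sum>(x, k)\<in>p. g (\<gamma> x) * (\<gamma> (Sup k) - \<gamma> (Inf k))) - I) -
       ((\<Sum>(x, k)\<in>p. h (\<gamma> x) * (\<gamma> (Sup k) - \<gamma> (Inf k))) - J)"
      by (simp add: case_prod_unfold sum_subtractf left_diff_distrib)
    moreover have "\<forall>(x, k)\<in>p. Sup k - Inf k < \<delta>1" "\<forall>(x, k)\<in>p. Sup k - Inf k < \<delta>2"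
      using p by auto
    note 1(2)[OF conjunct1[OF p] this(1)] 2(2)[OF conjunct1[OF p] this(2)]
    ultimately show "cmod ((\<Sum>(x, k)\<in>p. (g (\<gamma> x) - h (\<gamma> x)) * (\<gamma> (Sup k) - \<gamma> (Inf k))) - (I - J)) < e"
      using norm_triangle_ineq4 by (smt (verit) field_sum_of_halves)
  qed
qed

lemma norm_path_integral_le:
  assumes I: "has_path_integral g I (a, b, \<gamma>)" and rect: "rectifiable (a, b, \<gamma>)" "a \<le> b"
    and g: "\<And>x. x \<in> {a..b} \<Longrightarrow> cmod (g (\<gamma> x)) \<le> e" and "0 \<le> e"
  shows "cmod I \<le> e * variation \<gamma> a b"
proof (rule field_le_epsilon)
  fix \<eta> :: real assume "\<eta> > 0"
  then obtain \<delta> where \<delta>: "\<delta> > 0" "\<And>p. p tagged_division_of {a..b} \<Longrightarrow> (\<forall>(x, k)\<in>p. Sup k - Inf k < \<delta>) \<Longrightarrow>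
      cmod ((\<Sum>(x, k)\<in>p. g (\<gamma> x) * (\<gamma> (Sup k) - \<gamma> (Inf k))) - I) < \<eta>"
    using I unfolding has_path_integral_def split by meson
  obtain p where p: "p tagged_division_of {a..b}" "\<forall>(x, k)\<in>p. Sup k - Inf k < \<delta>"
    using tagged_division_fine_exists[OF \<delta>(1)] by blast
  have "cmod (\<Sum>(x, k)\<in>p. g (\<gamma> x) * (\<gamma> (Sup k) - \<gamma> (Inf k))) \<le> e * variation \<gamma> a b"
  proof (rule tagged_variation_sum_le[OF rect p(1) \<open>0 \<le> e\<close>])
    fix x k assume xk: "(x, k) \<in> p"
    note i = tagged_division_interval[OF p(1) xk]
    show "cmod (g (\<gamma> x) * (\<gamma> (Sup k) - \<gamma> (Inf k))) \<le> e * (variation \<gamma> a (Sup k) - variation \<gamma> a (Inf k))"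
      unfolding norm_mult
      by (intro mult_mono g norm_diff_le_variation_diff[OF rect(1)] norm_ge_zero \<open>0 \<le> e\<close>) (use i in auto)
  qed
  then show "cmod I \<le> e * variation \<gamma> a b + \<eta>"
    using \<delta>(2)[OF p] by (smt (verit) norm_minus_commute norm_triangle_ineq2)
qed

text \<open>\<open>F\<close> acts as a primitive along the path: its increments telescope to
  \<open>F b - F a\<close>, and the Riemann sum differs from them by at most \<open>e\<close> times
  the total variation. Existence of the integral comes with its value.\<close>

lemma has_path_integral_primitive:
  assumes rect: "rectifiable (a, b, \<gamma>)" "a \<le> b"
    and loc: "\<And>e. e > 0 \<Longrightarrow> \<exists>\<delta>>0. \<forall>s x t. a \<le> s \<and> s \<le> x \<and> x \<le> t \<and> t \<le> b \<and> t - s < \<delta> \<longrightarrow>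
      cmod (F t - F s - g (\<gamma> x) * (\<gamma> t - \<gamma> s)) \<le> e * (variation \<gamma> a t - variation \<gamma> a s)"
  shows "has_path_integral g (F b - F a) (a, b, \<gamma>)"
  unfolding has_path_integral_def split
proof (intro allI impI)
  fix e :: real assume "e > 0"
  define V where "V = variation \<gamma> a b"
  have V: "V \<ge> 0" unfolding V_def by (rule variation_nonneg[OF rect])
  define e' where "e' = e / (V + 1)"
  have e': "e' > 0" "e' * V < e"
    using \<open>e > 0\<close> V by (auto simp: e'_def field_simps)
  obtain \<delta> where \<delta>: "\<delta> > 0" "\<And>s x t. a \<le> s \<Longrightarrow> s \<le> x \<Longrightarrow> x \<le> t \<Longrightarrow> t \<le> b \<Longrightarrow> t - s < \<delta> \<Longrightarrow>
      cmod (F t - F s - g (\<gamma> x) * (\<gamma> t - \<gamma> s)) \<le> e' * (variation \<gamma> a t - variation \<gamma> a s)"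
    using loc[OF e'(1)] by blast
  show "\<exists>\<delta>>0. \<forall>p. p tagged_division_of {a..b} \<and> (\<forall>(x, k)\<in>p. Sup k - Inf k < \<delta>) \<longrightarrow>
      cmod ((\<Sum>(x, k)\<in>p. g (\<gamma> x) * (\<gamma> (Sup k) - \<gamma> (Inf k))) - (F b - F a)) < e"
  proof (intro exI[of _ \<delta>] conjI allI impI)
    fix p assume p: "p tagged_division_of {a..b} \<and> (\<forall>(x, k)\<in>p. Sup k - Inf k < \<delta>)"
    have "cmod (\<Sum>(x, k)\<in>p. F (Sup k) - F (Inf k) - g (\<gamma> x) * (\<gamma> (Sup k) - \<gamma> (Inf k))) \<le> e' * variation \<gamma> a b"
    proof (rule tagged_variation_sum_le[OF rect])
      show "p tagged_division_of {a..b}" "0 \<le> e'" using p e' by auto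
      fix x k assume xk: "(x, k) \<in> p"
      note i = tagged_division_interval[OF conjunct1[OF p] xk]
      show "cmod (F (Sup k) - F (Inf k) - g (\<gamma> x) * (\<gamma> (Sup k) - \<gamma> (Inf k)))
          \<le> e' * (variation \<gamma> a (Sup k) - variation \<gamma> a (Inf k))"
        by (rule \<delta>(2)) (use i p xk in auto)
    qed
    moreover have "(\<Sum>(x, k)\<in>p. F (Sup k) - F (Inf k) - g (\<gamma> x) * (\<gamma> (Sup k) - \<gamma> (Inf k)))
        = (F b - F a) - (\<Sum>(x, k)\<in>p. g (\<gamma> x) * (\<gamma> (Sup k) - \<gamma> (Inf k)))"
      using additive_tagged_division_1[OF rect(2) conjunct1[OF p], of F]
      by (simp add: case_prod_unfold sum_subtractf)
    ultimately show "cmod ((\<Sum>(x, k)\<in>p. g (\<gamma> x) * (\<gamma> (Sup k) - \<gamma> (Inf k))) - (F b - F a)) < e"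
      using e'(2) by (simp add: V_def norm_minus_commute)
  qed (use \<delta> in auto)
qed

lemma has_path_integral_const:
  assumes "rectifiable (a, b, \<gamma>)" "a \<le> b"
  shows "has_path_integral (\<lambda>_. c) (c * \<gamma> b - c * \<gamma> a) (a, b, \<gamma>)"
proof (rule has_path_integral_primitive[OF assms])
  fix e :: real assume "e > 0"
  show "\<exists>\<delta>>0. \<forall>s x t. a \<le> s \<and> s \<le> x \<and> x \<le> t \<and> t \<le> b \<and> t - s < \<delta> \<longrightarrow>
      cmod (c * \<gamma> t - c * \<gamma> s - c * (\<gamma> t - \<gamma> s)) \<le> e * (variation \<gamma> a t - variation \<gamma> a s)"
  proof (intro exI[of _ 1] conjI allI impI)
    fix s x t assume "a \<le> s \<and> s \<le> x \<and> x \<le> t \<and> t \<le> b \<and> t - s < 1"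
    then have "0 \<le> variation \<gamma> a t - variation \<gamma> a s"
      by (intro order_trans[OF norm_ge_zero norm_diff_le_variation_diff[OF assms(1)]]) auto
    then show "cmod (c * \<gamma> t - c * \<gamma> s - c * (\<gamma> t - \<gamma> s)) \<le> e * (variation \<gamma> a t - variation \<gamma> a s)"
      using \<open>e > 0\<close> by (simp add: algebra_simps)
  qed simp
qed

text \<open>Choosing tags makes the telescoping over tagged divisions available for the plain
  divisions in \<open>variation_sums\<close>.\<close>

lemma division_of_tag_Inf:
  fixes a b :: real
  assumes d: "d division_of {a..b}"
  shows "(\<lambda>k. (Inf k, k)) ` d tagged_division_of {a..b}"
proof (rule tagged_division_ofI)
  note D = division_ofD[OF d]
  show "finite ((\<lambda>k. (Inf k, k)) ` d)" using D(1) by simp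
  fix x k assume "(x, k) \<in> (\<lambda>k. (Inf k, k)) ` d"
  then have k: "k \<in> d" "x = Inf k" by auto
  obtain u v where uv: "k = cbox u v" using D(4) k by blast
  have "k \<noteq> {}" using D(3) k by blast
  then show "x \<in> k" using uv k(2) by auto
  show "k \<subseteq> {a..b}" using D(2) k by blast
  show "\<exists>u v. k = cbox u v" using uv by blast
  fix x' k' assume "(x', k') \<in> (\<lambda>k. (Inf k, k)) ` d" "(x, k) \<noteq> (x', k')"
  then show "interior k \<inter> interior k' = {}"
    using D(5)[of k k'] k by auto
next
  have "{k. \<exists>x. (x, k) \<in> (\<lambda>k. (Inf k, k)) ` d} = d" by auto
  then show "\<Union>{k. \<exists>x. (x, k) \<in> (\<lambda>k. (Inf k, k)) ` d} = {a..b}"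
    using division_ofD(6)[OF d] by simp
qed

text \<open>Near a point \<open>\<gamma> t\<close> with \<open>h (\<gamma> t) \<noteq> 0\<close> the vanishing integrals bound all chords of \<open>\<gamma>\<close>
  by half the variation between their endpoints, which makes the variation vanish.\<close>

lemma zero_path_integrals_imp_zero:
  assumes rect: "rectifiable (a, b, \<gamma>)" and "a < b" and inj: "inj_on \<gamma> {a..b}"
    and cont: "continuous_on {a..b} (\<lambda>t. h (\<gamma> t))"
    and zero: "\<And>c d. a \<le> c \<Longrightarrow> c < d \<Longrightarrow> d \<le> b \<Longrightarrow> has_path_integral h 0 (c, d, \<gamma>)"
    and t: "t \<in> {a..b}"
  shows "h (\<gamma> t) = 0"
proof (rule ccontr)
  define h0 where "h0 = h (\<gamma> t)"
  assume "h (\<gamma> t) \<noteq> 0"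
  then have h0: "cmod h0 / 2 > 0" by (simp add: h0_def)
  then obtain \<rho> where \<rho>: "\<rho> > 0" "\<And>r. r \<in> {a..b} \<Longrightarrow> dist r t < \<rho> \<Longrightarrow> dist (h (\<gamma> r)) h0 < cmod h0 / 2"
    using cont t unfolding continuous_on_iff h0_def by meson
  \<comment> \<open>The window is cut off at \<open>a\<close> and \<open>b\<close>, and it is
    nondegenerate even if \<open>t\<close> is an end point.\<close>
  define c where "c = max a (t - \<rho> / 2)"
  define d where "d = min b (t + \<rho> / 2)"
  have cd: "a \<le> c" "c < d" "d \<le> b" "t - \<rho> / 2 \<le> c" "d \<le> t + \<rho> / 2"
    using t \<rho>(1) \<open>a < b\<close> by (auto simp: c_def d_def)
  have near: "cmod (h0 - h (\<gamma> r)) \<le> cmod h0 / 2" if "r \<in> {c..d}" for r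
  proof -
    have "dist r t < \<rho>"
      using that cd \<rho>(1) unfolding dist_real_def by auto
    then have "dist (h (\<gamma> r)) h0 < cmod h0 / 2"
      using that cd by (intro \<rho>(2)) auto
    then show ?thesis by (simp add: dist_norm norm_minus_commute)
  qed
  have rcd: "rectifiable (c, d, \<gamma>)"
  proof -
    have "rectifiable (a, d, \<gamma>)"
      by (rule rectifiable_variation_subinterval(1)[OF rect]) (use cd in auto)
    then show ?thesis
      by (rule rectifiable_variation_subinterval(1)) (use cd in auto)
  qed
  have half: "cmod (\<gamma> u - \<gamma> s) \<le> 1 / 2 * (variation \<gamma> c u - variation \<gamma> c s)"
    if su: "c \<le> s" "s \<le> u" "u \<le> d" for s u
  proof (cases "s = u")
    case False
    have rsu: "rectifiable (s, u, \<gamma>)"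
      by (rule rectifiable_variation_subinterval(1)[OF rcd su])
    \<comment> \<open>As \<open>h\<close> integrates to 0, the chord times \<open>h0\<close> is the
      integral of \<open>h0 - h\<close>, and the integrand has at most half the norm of
      \<open>h0\<close> in the window.\<close>
    have "has_path_integral (\<lambda>z. h0 - h z) (h0 * \<gamma> u - h0 * \<gamma> s - 0) (s, u, \<gamma>)"
      by (intro has_path_integral_diff has_path_integral_const rsu zero) (use su cd False in auto)
    from norm_path_integral_le[OF this rsu, of "cmod h0 / 2"]
    have "cmod (h0 * \<gamma> u - h0 * \<gamma> s - 0) \<le> cmod h0 / 2 * variation \<gamma> s u"
      using su near by auto
    then have "cmod h0 * cmod (\<gamma> u - \<gamma> s) \<le> cmod h0 * (variation \<gamma> s u / 2)"
      by (simp add: norm_mult flip: right_diff_distrib)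
    then have "cmod (\<gamma> u - \<gamma> s) \<le> variation \<gamma> s u / 2"
      using h0 by (subst (asm) mult_le_cancel_left_pos) auto
    moreover have "variation \<gamma> s u \<le> variation \<gamma> c u - variation \<gamma> c s"
      using rectifiable_variation_subinterval(2)[OF rcd su] by linarith
    ultimately show ?thesis by simp
  qed simp
  have "variation \<gamma> c d \<le> 1 / 2 * variation \<gamma> c d"
  proof (rule variation_le)
    fix D assume D: "D division_of {c..d}"
    define p where "p = (\<lambda>k. (Inf k, k)) ` D"
    have p: "p tagged_division_of {c..d}"
      unfolding p_def by (rule division_of_tag_Inf[OF D])
    have "var_sum \<gamma> D = (\<Sum>(x, k)\<in>p. cmod (\<gamma> (Sup k) - \<gamma> (Inf k)))"
      unfolding p_def by (subst sum.reindex) (auto simp: inj_on_def)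
    also have "\<dots> \<le> (\<Sum>(x, k)\<in>p. 1 / 2 * (variation \<gamma> c (Sup k) - variation \<gamma> c (Inf k)))"
    proof (intro sum_mono, clarify)
      fix x k assume "(x, k) \<in> p"
      note i = tagged_division_interval[OF p this]
      show "cmod (\<gamma> (Sup k) - \<gamma> (Inf k)) \<le> 1 / 2 * (variation \<gamma> c (Sup k) - variation \<gamma> c (Inf k))"
        by (rule half) (use i in auto)
    qed
    also have "\<dots> = 1 / 2 * (\<Sum>(x, k)\<in>p. variation \<gamma> c (Sup k) - variation \<gamma> c (Inf k))"
      by (simp add: sum_distrib_left case_prod_unfold)
    also have "\<dots> = 1 / 2 * (variation \<gamma> c d - variation \<gamma> c c)"
      using additive_tagged_division_1[OF less_imp_le[OF cd(2)] p, of "variation \<gamma> c"] by simp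
    also have "\<dots> \<le> 1 / 2 * variation \<gamma> c d"
      using variation_nonneg[OF rectifiable_variation_subinterval(1)[OF rcd, of c c]] cd(2) by simp
    finally show "var_sum \<gamma> D \<le> 1 / 2 * variation \<gamma> c d" .
  qed
  then have "cmod (\<gamma> d - \<gamma> c) \<le> 0"
    using norm_diff_le_variation[OF rcd] cd(2) by linarith
  then have "\<gamma> d = \<gamma> c" by simp
  then have "d = c"
    using inj_onD[OF inj] cd by auto
  with cd(2) show False by simp
qed

text \<open>A mean value inequality along the path. \<open>\<gamma>\<close> need not be
  differentiable and \<open>X\<close> need not contain its chords, so the derivative gives an
  estimate only near each parameter, with a radius depending on it. A tagged division subordinate to
  these radii adds up the pointwise estimates.\<close>

lemma increment_le_variation:
  assumes rect: "rectifiable (a, b, \<gamma>)" and st: "a \<le> s" "s \<le> t" "t \<le> b"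
    and \<gamma>: "continuous_on {a..b} \<gamma>" "\<gamma> ` {a..b} \<subseteq> X"
    and f': "\<And>z. z \<in> X \<Longrightarrow> (f has_field_derivative f' z) (at z within X)"
    and c: "\<And>r. r \<in> {s..t} \<Longrightarrow> cmod (f' (\<gamma> r) - c) \<le> e" and "0 \<le> e"
  shows "cmod (f (\<gamma> t) - f (\<gamma> s) - c * (\<gamma> t - \<gamma> s)) \<le> e * variation \<gamma> s t"
proof (rule field_le_epsilon)
  fix \<epsilon> :: real assume "\<epsilon> > 0"
  have rst: "rectifiable (s, t, \<gamma>)"
  proof -
    have "rectifiable (a, t, \<gamma>)"
      by (rule rectifiable_variation_subinterval(1)[OF rect]) (use st in auto)
    then show ?thesis
      by (rule rectifiable_variation_subinterval(1)) (use st in auto)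
  qed
  define V where "V = variation \<gamma> s t"
  have V: "V \<ge> 0" unfolding V_def by (rule variation_nonneg[OF rst st(2)])
  define \<eta> where "\<eta> = \<epsilon> / (V + 1)"
  have \<eta>: "\<eta> > 0" "\<eta> * V \<le> \<epsilon>"
    using \<open>\<epsilon> > 0\<close> V by (auto simp: \<eta>_def field_simps)
  define E where "E = (\<lambda>u v. f (\<gamma> v) - f (\<gamma> u) - c * (\<gamma> v - \<gamma> u))"
  have "\<exists>\<delta>>0. \<forall>u\<in>{s..t}. dist u r < \<delta> \<longrightarrow> cmod (E r u) \<le> (e + \<eta>) * cmod (\<gamma> u - \<gamma> r)"
    if r: "r \<in> {s..t}" for r
  proof -
    have rX: "\<gamma> r \<in> X" using \<gamma>(2) r st by auto
    obtain \<rho> where \<rho>: "\<rho> > 0" "\<And>w. w \<in> X \<Longrightarrow> cmod (w - \<gamma> r) < \<rho> \<Longrightarrow>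
        cmod (f w - f (\<gamma> r) - f' (\<gamma> r) * (w - \<gamma> r)) \<le> \<eta> * cmod (w - \<gamma> r)"
      using f'[OF rX] \<eta>(1) unfolding has_field_derivative_def has_derivative_within_alt by blast
    obtain \<delta> where \<delta>: "\<delta> > 0" "\<And>u. u \<in> {a..b} \<Longrightarrow> dist u r < \<delta> \<Longrightarrow> dist (\<gamma> u) (\<gamma> r) < \<rho>"
      using \<gamma>(1) r st \<rho>(1) unfolding continuous_on_iff by (metis atLeastAtMost_iff order_trans)
    have "cmod (E r u) \<le> (e + \<eta>) * cmod (\<gamma> u - \<gamma> r)" if u: "u \<in> {s..t}" "dist u r < \<delta>" for u
    proof -
      have uX: "\<gamma> u \<in> X" using \<gamma>(2) u st by auto
      have "cmod (\<gamma> u - \<gamma> r) < \<rho>"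
        using \<delta>(2)[of u] u st by (auto simp: dist_norm)
      note 1 = \<rho>(2)[OF uX this]
      have 2: "cmod ((f' (\<gamma> r) - c) * (\<gamma> u - \<gamma> r)) \<le> e * cmod (\<gamma> u - \<gamma> r)"
        unfolding norm_mult by (intro mult_right_mono c r) auto
      have E: "E r u = (f (\<gamma> u) - f (\<gamma> r) - f' (\<gamma> r) * (\<gamma> u - \<gamma> r)) + (f' (\<gamma> r) - c) * (\<gamma> u - \<gamma> r)"
        unfolding E_def by (simp add: algebra_simps)
      have "cmod (E r u) \<le> \<eta> * cmod (\<gamma> u - \<gamma> r) + e * cmod (\<gamma> u - \<gamma> r)"
        unfolding E by (intro norm_triangle_le add_mono 1 2)
      then show ?thesis by (simp add: distrib_right add.commute)
    qed
    with \<delta>(1) show ?thesis by blast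
  qed
  then obtain \<delta> where \<delta>: "\<And>r. r \<in> {s..t} \<Longrightarrow> \<delta> r > 0"
    "\<And>r u. r \<in> {s..t} \<Longrightarrow> u \<in> {s..t} \<Longrightarrow> dist u r < \<delta> r \<Longrightarrow> cmod (E r u) \<le> (e + \<eta>) * cmod (\<gamma> u - \<gamma> r)"
    by metis
  have "gauge (\<lambda>r. ball r (if r \<in> {s..t} then \<delta> r else 1))"
    using \<delta>(1) by (intro gauge_ball_dependent) auto
  then obtain p where p: "p tagged_division_of {s..t}" "(\<lambda>r. ball r (if r \<in> {s..t} then \<delta> r else 1)) fine p"
    using fine_division_exists_real by blast
  have "cmod (\<Sum>(x, k)\<in>p. E (Inf k) (Sup k)) \<le> (e + \<eta>) * variation \<gamma> s t"
  proof (rule tagged_variation_sum_le[OF rst st(2) p(1)])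
    fix x k assume xk: "(x, k) \<in> p"
    note i = tagged_division_interval[OF p(1) xk]
    have x: "x \<in> {s..t}" using i by auto
    then have "k \<subseteq> ball x (\<delta> x)"
      using p(2) xk unfolding fine_def by fastforce
    then have "dist (Inf k) x < \<delta> x" "dist (Sup k) x < \<delta> x"
      using i(1,2) by (auto simp: dist_commute)
    then have "cmod (E x (Inf k)) \<le> (e + \<eta>) * cmod (\<gamma> (Inf k) - \<gamma> x)"
      "cmod (E x (Sup k)) \<le> (e + \<eta>) * cmod (\<gamma> (Sup k) - \<gamma> x)"
      using i by (auto intro!: \<delta>(2)[OF x])
    moreover have "(e + \<eta>) * cmod (\<gamma> (Inf k) - \<gamma> x) \<le> (e + \<eta>) * (variation \<gamma> s x - variation \<gamma> s (Inf k))"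
      using norm_diff_le_variation_diff[OF rst, of "Inf k" x] i \<open>0 \<le> e\<close> \<eta>(1)
      by (intro mult_left_mono) (auto simp: norm_minus_commute)
    moreover have "(e + \<eta>) * cmod (\<gamma> (Sup k) - \<gamma> x) \<le> (e + \<eta>) * (variation \<gamma> s (Sup k) - variation \<gamma> s x)"
      using norm_diff_le_variation_diff[OF rst, of x "Sup k"] i \<open>0 \<le> e\<close> \<eta>(1)
      by (intro mult_left_mono) auto
    \<comment> \<open>Both ends are compared with the tag, which is the point where the derivative
      estimate holds; \<open>E\<close> is additive.\<close>
    moreover have "E (Inf k) (Sup k) = E x (Sup k) - E x (Inf k)"
      unfolding E_def by (simp add: algebra_simps)
    then have "cmod (E (Inf k) (Sup k)) \<le> cmod (E x (Sup k)) + cmod (E x (Inf k))"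
      by (metis norm_triangle_ineq4)
    ultimately show "cmod (E (Inf k) (Sup k)) \<le> (e + \<eta>) * (variation \<gamma> s (Sup k) - variation \<gamma> s (Inf k))"
      by (simp add: algebra_simps)
  qed (use \<open>0 \<le> e\<close> \<eta>(1) in auto)
  moreover have "(\<Sum>(x, k)\<in>p. E (Inf k) (Sup k)) = E s t"
    using additive_tagged_division_1[OF st(2) p(1), of "\<lambda>r. f (\<gamma> r) - c * \<gamma> r"]
    by (simp add: E_def algebra_simps)
  ultimately have "cmod (E s t) \<le> (e + \<eta>) * variation \<gamma> s t" by simp
  also have "\<dots> \<le> e * variation \<gamma> s t + \<epsilon>"
    using \<eta>(2) by (simp add: V_def distrib_right)
  finally show "cmod (f (\<gamma> t) - f (\<gamma> s) - c * (\<gamma> t - \<gamma> s)) \<le> e * variation \<gamma> s t + \<epsilon>"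
    unfolding E_def .
qed

text \<open>Uniform continuity of \<open>f'\<close> along the path makes
  \<open>f' (\<gamma> x)\<close> a suitable constant for the mean value inequality on every short
  interval around \<open>x\<close>.\<close>

lemma has_path_integral_derivative:
  assumes rect: "rectifiable (a, b, \<gamma>)" "a \<le> b"
    and \<gamma>: "continuous_on {a..b} \<gamma>" "\<gamma> ` {a..b} \<subseteq> X"
    and f': "\<And>z. z \<in> X \<Longrightarrow> (f has_field_derivative f' z) (at z within X)" "continuous_on X f'"
  shows "has_path_integral f' (f (\<gamma> b) - f (\<gamma> a)) (a, b, \<gamma>)"
proof (rule has_path_integral_primitive[OF rect, where F = "\<lambda>t. f (\<gamma> t)"])
  fix e :: real assume "e > 0"
  have "uniformly_continuous_on {a..b} (\<lambda>t. f' (\<gamma> t))"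
    using \<gamma> f'(2) by (intro compact_uniformly_continuous) (auto intro: continuous_on_compose2)
  then obtain \<delta> where \<delta>: "\<delta> > 0" "\<And>r u. r \<in> {a..b} \<Longrightarrow> u \<in> {a..b} \<Longrightarrow> dist u r < \<delta> \<Longrightarrow> dist (f' (\<gamma> u)) (f' (\<gamma> r)) < e"
    using \<open>e > 0\<close> unfolding uniformly_continuous_on_def by meson
  have "cmod (f (\<gamma> t) - f (\<gamma> s) - f' (\<gamma> x) * (\<gamma> t - \<gamma> s)) \<le> e * (variation \<gamma> a t - variation \<gamma> a s)"
    if x: "a \<le> s" "s \<le> x" "x \<le> t" "t \<le> b" "t - s < \<delta>" for s x t
  proof -
    have "cmod (f (\<gamma> t) - f (\<gamma> s) - f' (\<gamma> x) * (\<gamma> t - \<gamma> s)) \<le> e * variation \<gamma> s t"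
    proof (rule increment_le_variation[OF rect(1) _ _ _ \<gamma> f'(1)])
      fix r assume "r \<in> {s..t}"
      then have "dist r x < \<delta>" "r \<in> {a..b}" "x \<in> {a..b}"
        using x by (auto simp: dist_real_def)
      then show "cmod (f' (\<gamma> r) - f' (\<gamma> x)) \<le> e"
        using \<delta>(2)[of x r] by (simp add: dist_norm)
    qed (use x \<open>e > 0\<close> in auto)
    also have "\<dots> \<le> e * (variation \<gamma> a t - variation \<gamma> a s)"
      using rectifiable_variation_subinterval(2)[OF rect(1), of s t] x \<open>e > 0\<close>
      by (intro mult_left_mono) auto
    finally show ?thesis .
  qed
  with \<delta>(1) show "\<exists>\<delta>>0. \<forall>s x t. a \<le> s \<and> s \<le> x \<and> x \<le> t \<and> t \<le> b \<and> t - s < \<delta> \<longrightarrow>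
      cmod (f (\<gamma> t) - f (\<gamma> s) - f' (\<gamma> x) * (\<gamma> t - \<gamma> s)) \<le> e * (variation \<gamma> a t - variation \<gamma> a s)"
    by blast
qed

section \<open>The derivative along useful paths\<close>

lemma useful_path:
  assumes "useful X F" "(a, b, \<gamma>) \<in> F"
  shows "a < b" "continuous_on {a..b} \<gamma>" "\<gamma> ` {a..b} \<subseteq> X" "inj_on \<gamma> {a..b}" "rectifiable (a, b, \<gamma>)"
proof -
  have "jordan_arc_in X (a, b, \<gamma>)" "rectifiable (a, b, \<gamma>)"
    using assms unfolding useful_def by blast+
  then show "a < b" "continuous_on {a..b} \<gamma>" "\<gamma> ` {a..b} \<subseteq> X" "inj_on \<gamma> {a..b}" "rectifiable (a, b, \<gamma>)"
    by (simp_all add: jordan_arc_in_def path_in_def)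
qed

lemma useful_path_restrict:
  assumes "useful X F" "(a, b, \<gamma>) \<in> F" "a \<le> c" "c < d" "d \<le> b"
  shows "(c, d, restrict \<gamma> {c..d}) \<in> F"
proof -
  have "\<forall>(a, b, \<gamma>)\<in>F. \<forall>c d. c < d \<and> {c..d} \<subseteq> {a..b} \<longrightarrow> (c, d, restrict \<gamma> {c..d}) \<in> F"
    using assms(1) unfolding useful_def by blast
  then have "\<forall>c d. c < d \<and> {c..d} \<subseteq> {a..b} \<longrightarrow> (c, d, restrict \<gamma> {c..d}) \<in> F"
    using assms(2) by fast
  then show ?thesis using assms(3-5) by simp
qed

lemma F_derivative_in_DF_space: "F_derivative X F f g \<Longrightarrow> f \<in> DF_space X F"
  unfolding DF_space_def F_derivative_def by blast

lemma F_derivative_integral: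
  assumes "F_derivative X F f g" "(a, b, \<gamma>) \<in> F"
  shows "has_path_integral g (f (\<gamma> b) - f (\<gamma> a)) (a, b, \<gamma>)"
  using assms unfolding F_derivative_def by fast

lemma F_derivative_integral_subpath:
  assumes "useful X F" "F_derivative X F f g" "(a, b, \<gamma>) \<in> F" "a \<le> c" "c < d" "d \<le> b"
  shows "has_path_integral g (f (\<gamma> d) - f (\<gamma> c)) (c, d, \<gamma>)"
  using F_derivative_integral[OF assms(2) useful_path_restrict[OF assms(1,3-6)]] assms(5)
    has_path_integral_cong[of c d "restrict \<gamma> {c..d}" \<gamma>] by simp

text \<open>Closure of \<open>F\<close> under restriction makes the integrals of the difference
  vanish over all subpaths; hence the difference vanishes on the paths and, by density and
  continuity, on \<open>X\<close>.\<close>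

lemma F_derivative_unique:
  assumes F: "useful X F" "closure (paths_image F) = X"
    and g: "F_derivative X F f g1" "F_derivative X F f g2"
  shows "g1 = g2"
proof -
  have C: "continuous_on X g1" "continuous_on X g2" "g1 \<in> extensional X" "g2 \<in> extensional X"
    using g by (auto simp: F_derivative_def C_space_def)
  define h where "h = (\<lambda>z. g1 z - g2 z)"
  have zero: "h z = 0" if z: "z \<in> paths_image F" for z
  proof -
    obtain y where "y \<in> F" "z \<in> (case y of (a, b, \<gamma>) \<Rightarrow> \<gamma> ` {a..b})"
      using z unfolding paths_image_def by blast
    then obtain a b \<gamma> t where p: "(a, b, \<gamma>) \<in> F" "t \<in> {a..b}" "z = \<gamma> t"
      by (cases y) auto
    note u = useful_path[OF F(1) p(1)]
    have "h (\<gamma> t) = 0"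
    proof (rule zero_path_integrals_imp_zero[OF u(5,1,4) _ _ p(2)])
      show "continuous_on {a..b} (\<lambda>t. h (\<gamma> t))"
        unfolding h_def
        by (intro continuous_on_diff continuous_on_compose2[OF C(1) u(2,3)] continuous_on_compose2[OF C(2) u(2,3)])
      show "has_path_integral h 0 (c, d, \<gamma>)" if "a \<le> c" "c < d" "d \<le> b" for c d
        using has_path_integral_diff[OF F_derivative_integral_subpath[OF F(1) g(1) p(1) that]
            F_derivative_integral_subpath[OF F(1) g(2) p(1) that]]
        by (simp add: h_def)
    qed
    then show ?thesis using p(3) by simp
  qed
  have "h z = 0" if "z \<in> X" for z
  proof (rule continuous_constant_on_closure[of "paths_image F" h])
    show "continuous_on (closure (paths_image F)) h"
      unfolding F(2) h_def by (intro continuous_on_diff C)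
  qed (use zero that F(2) in auto)
  then show ?thesis
    by (intro extensionalityI[OF C(3,4)]) (auto simp: h_def)
qed

lemma F_derivative_diff:
  assumes F: "useful X F" and f: "F_derivative X F f1 g1" "F_derivative X F f2 g2"
  shows "F_derivative X F (\<lambda>z\<in>X. f1 z - f2 z) (\<lambda>z\<in>X. g1 z - g2 z)"
proof -
  have C: "(\<lambda>z\<in>X. u z - v z) \<in> C_space X" if "u \<in> C_space X" "v \<in> C_space X" for u v
    using that unfolding C_space_def by (auto intro!: continuous_intros)
  have "has_path_integral (\<lambda>z\<in>X. g1 z - g2 z) ((\<lambda>z\<in>X. f1 z - f2 z) (\<gamma> b) - (\<lambda>z\<in>X. f1 z - f2 z) (\<gamma> a)) (a, b, \<gamma>)"
    if p: "(a, b, \<gamma>) \<in> F" for a b \<gamma>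
  proof -
    note u = useful_path[OF F p]
    have ab: "\<gamma> a \<in> X" "\<gamma> b \<in> X" using u(1,3) by auto
    have "(\<Sum>(x, k)\<in>q. (\<lambda>z\<in>X. g1 z - g2 z) (\<gamma> x) * (\<gamma> (Sup k) - \<gamma> (Inf k))) =
       (\<Sum>(x, k)\<in>q. (g1 (\<gamma> x) - g2 (\<gamma> x)) * (\<gamma> (Sup k) - \<gamma> (Inf k)))" if q: "q tagged_division_of {a..b}" for q
    proof (intro sum.cong refl, clarify)
      fix x k assume "(x, k) \<in> q"
      then have "x \<in> {a..b}" using tag_in_interval[OF q] by blast
      then have "\<gamma> x \<in> X" using u(3) by auto
      then show "(\<lambda>z\<in>X. g1 z - g2 z) (\<gamma> x) * (\<gamma> (Sup k) - \<gamma> (Inf k)) = (g1 (\<gamma> x) - g2 (\<gamma> x)) * (\<gamma> (Sup k) - \<gamma> (Inf k))"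
        by simp
    qed
    then have "has_path_integral (\<lambda>z\<in>X. g1 z - g2 z) I (a, b, \<gamma>) \<longleftrightarrow> has_path_integral (\<lambda>z. g1 z - g2 z) I (a, b, \<gamma>)" for I
      unfolding has_path_integral_def by simp
    moreover have "has_path_integral (\<lambda>z. g1 z - g2 z) (f1 (\<gamma> b) - f1 (\<gamma> a) - (f2 (\<gamma> b) - f2 (\<gamma> a))) (a, b, \<gamma>)"
      by (intro has_path_integral_diff F_derivative_integral[OF f(1) p] F_derivative_integral[OF f(2) p])
    ultimately show ?thesis
      using ab by (simp add: algebra_simps)
  qed
  then show ?thesis
    using C f unfolding F_derivative_def by blast
qed

text \<open>Uniqueness lets \<open>THE\<close> in \<open>DF_norm\<close> return the difference of
  the given derivatives.\<close>

lemma DF_norm_le: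
  assumes F: "useful X F" "closure (paths_image F) = X" and "X \<noteq> {}"
    and f: "F_derivative X F f1 g1" "F_derivative X F f2 g2"
    and le: "\<And>z. z \<in> X \<Longrightarrow> cmod (f1 z - f2 z) \<le> A" "\<And>z. z \<in> X \<Longrightarrow> cmod (g1 z - g2 z) \<le> B"
  shows "DF_norm X F (\<lambda>z\<in>X. f1 z - f2 z) \<le> A + B"
proof -
  note D = F_derivative_diff[OF F(1) f]
  have "(THE g. F_derivative X F (\<lambda>z\<in>X. f1 z - f2 z) g) = (\<lambda>z\<in>X. g1 z - g2 z)"
    using D F_derivative_unique[OF F] by (intro the_equality) auto
  then show ?thesis
    unfolding DF_norm_def sup_norm_def
    by (auto intro!: add_mono cSUP_least \<open>X \<noteq> {}\<close> le)
qed

lemma D1_F_derivative: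
  assumes F: "useful X F" and f: "f \<in> extensional X" "f' \<in> C_space X"
    "\<And>z. z \<in> X \<Longrightarrow> (f has_field_derivative f' z) (at z within X)"
  shows "F_derivative X F f f'"
proof -
  have "continuous_on X f"
    using f(3) by (rule DERIV_continuous_on)
  moreover have "has_path_integral f' (f (\<gamma> b) - f (\<gamma> a)) (a, b, \<gamma>)" if "(a, b, \<gamma>) \<in> F" for a b \<gamma>
    using useful_path[OF F that] f(2,3)
    by (intro has_path_integral_derivative[where X = X]) (auto simp: C_space_def)
  ultimately show ?thesis
    using f unfolding F_derivative_def C_space_def by auto
qed

lemma restrict_poly_in_C_space: "(\<lambda>z\<in>X. poly p z) \<in> C_space X"
  unfolding C_space_def by (auto intro!: continuous_intros)

lemma restrict_poly_derivative:
  assumes "z \<in> X"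
  shows "((\<lambda>z\<in>X. poly p z) has_field_derivative (\<lambda>z\<in>X. poly (pderiv p) z) z) (at z within X)"
proof -
  have "(poly p has_field_derivative poly (pderiv p) z) (at z within X)"
    by (rule has_field_derivative_at_within[OF poly_DERIV])
  then have "((\<lambda>z\<in>X. poly p z) has_field_derivative poly (pderiv p) z) (at z within X)"
    by (rule has_field_derivative_transform_within[OF _ zero_less_one assms]) simp
  then show ?thesis using assms by simp
qed

lemma restrict_poly_F_derivative:
  assumes "useful X F"
  shows "F_derivative X F (\<lambda>z\<in>X. poly p z) (\<lambda>z\<in>X. poly (pderiv p) z)"
  by (rule D1_F_derivative[OF assms _ restrict_poly_in_C_space restrict_poly_derivative]) auto

section \<open>Locally constant functions\<close>

text \<open>Approximation as in the norm of \<open>D\<close>, with 0 in the place of the derivative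
  of \<open>u\<close>; \<open>u\<close> itself is an arbitrary function.\<close>

definition flat_approx :: "complex set \<Rightarrow> (complex \<Rightarrow> complex) \<Rightarrow> bool" where
  "flat_approx X u \<longleftrightarrow>
     (\<forall>e>0. \<exists>p. \<forall>z\<in>X. cmod (u z - poly p z) < e \<and> cmod (poly (pderiv p) z) < e)"

lemma flat_approx_const: "flat_approx X (\<lambda>_. c)"
  unfolding flat_approx_def by (intro allI impI exI[of _ "[:c:]"]) (auto simp: pderiv_pCons)

lemma flat_approx_add:
  assumes "flat_approx X u" "flat_approx X v"
  shows "flat_approx X (\<lambda>z. u z + v z)"
  unfolding flat_approx_def
proof (intro allI impI)
  fix e :: real assume "e > 0"
  obtain p where p: "\<And>z. z \<in> X \<Longrightarrow> cmod (u z - poly p z) < e / 2" "\<And>z. z \<in> X \<Longrightarrow> cmod (poly (pderiv p) z) < e / 2"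
    using assms(1) half_gt_zero[OF \<open>e > 0\<close>] unfolding flat_approx_def by meson
  obtain q where q: "\<And>z. z \<in> X \<Longrightarrow> cmod (v z - poly q z) < e / 2" "\<And>z. z \<in> X \<Longrightarrow> cmod (poly (pderiv q) z) < e / 2"
    using assms(2) half_gt_zero[OF \<open>e > 0\<close>] unfolding flat_approx_def by meson
  have "cmod (u z + v z - poly (p + q) z) < e \<and> cmod (poly (pderiv (p + q)) z) < e" if z: "z \<in> X" for z
  proof
    have "u z + v z - poly (p + q) z = (u z - poly p z) + (v z - poly q z)" by simp
    also have "cmod \<dots> < e / 2 + e / 2"
      by (rule norm_add_less[OF p(1)[OF z] q(1)[OF z]])
    finally show "cmod (u z + v z - poly (p + q) z) < e" by simp
    show "cmod (poly (pderiv (p + q)) z) < e"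
      using norm_triangle_ineq[of "poly (pderiv p) z" "poly (pderiv q) z"] p(2)[OF z] q(2)[OF z]
      by (simp add: pderiv_add)
  qed
  then show "\<exists>p. \<forall>z\<in>X. cmod (u z + v z - poly p z) < e \<and> cmod (poly (pderiv p) z) < e"
    by blast
qed

lemma flat_approx_mult:
  assumes X: "compact X" and u: "flat_approx X u" and v: "flat_approx X v"
  shows "flat_approx X (\<lambda>z. u z * v z)"
proof -
  have bd: "\<exists>B>0. \<forall>z\<in>X. cmod (w z) \<le> B" if w: "flat_approx X w" for w
  proof -
    have "poly_approx X w"
      unfolding poly_approx_def
    proof (intro allI impI)
      fix e :: real assume "e > 0"
      then obtain p where "\<forall>z\<in>X. cmod (w z - poly p z) < e \<and> cmod (poly (pderiv p) z) < e"
        using w unfolding flat_approx_def by blast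
      then show "\<exists>p. \<forall>z\<in>X. cmod (w z - poly p z) < e" by blast
    qed
    then obtain B where "B > 0" "\<And>z. z \<in> X \<Longrightarrow> cmod (w z) \<le> B"
      using poly_approx_bounded[OF X] by blast
    then show ?thesis by blast
  qed
  obtain A where A: "A > 0" "\<And>z. z \<in> X \<Longrightarrow> cmod (u z) \<le> A" using bd[OF u] by blast
  obtain B where B: "B > 0" "\<And>z. z \<in> X \<Longrightarrow> cmod (v z) \<le> B" using bd[OF v] by blast
  show ?thesis
    unfolding flat_approx_def
  proof (intro allI impI)
    fix e :: real assume "e > 0"
    \<comment> \<open>\<open>d \<le> 1\<close> gives the bounds \<open>A + 1\<close> and
      \<open>B + 1\<close> for the polynomials; the product rule then costs
      \<open>d * (A + 1) + d * (B + 1)\<close>.\<close>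
    define d where "d = min 1 (e / (A + B + 2))"
    have AB: "A + B + 2 > 0" using A B by simp
    have d: "d > 0" "d \<le> 1" "d * (A + B + 2) \<le> e"
    proof -
      show "d > 0" "d \<le> 1" using \<open>e > 0\<close> AB by (auto simp: d_def)
      have "d \<le> e / (A + B + 2)" by (simp add: d_def)
      then show "d * (A + B + 2) \<le> e" using AB by (simp add: pos_le_divide_eq)
    qed
    obtain p where p: "\<And>z. z \<in> X \<Longrightarrow> cmod (u z - poly p z) < d" "\<And>z. z \<in> X \<Longrightarrow> cmod (poly (pderiv p) z) < d"
      using u d(1) unfolding flat_approx_def by meson
    obtain q where q: "\<And>z. z \<in> X \<Longrightarrow> cmod (v z - poly q z) < d" "\<And>z. z \<in> X \<Longrightarrow> cmod (poly (pderiv q) z) < d"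
      using v d(1) unfolding flat_approx_def by meson
    have "cmod (u z * v z - poly (p * q) z) < e \<and> cmod (poly (pderiv (p * q)) z) < e" if z: "z \<in> X" for z
    proof
      have pA: "cmod (poly p z) \<le> A + 1"
        using norm_triangle_ineq3[of "u z" "poly p z"] p(1)[OF z] A(2)[OF z] d(2) by linarith
      have qB: "cmod (poly q z) \<le> B + 1"
        using norm_triangle_ineq3[of "v z" "poly q z"] q(1)[OF z] B(2)[OF z] d(2) by linarith
      have "u z * v z - poly (p * q) z = (u z - poly p z) * v z + poly p z * (v z - poly q z)"
        by (simp add: algebra_simps)
      also have "cmod \<dots> \<le> d * B + (A + 1) * d"
        by (intro norm_triangle_le add_mono; unfold norm_mult)
          (intro mult_mono less_imp_le[OF p(1)] less_imp_le[OF q(1)] pA B z; use d A in simp)+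
      also have "\<dots> < d * (A + B + 2)" using d(1) by (simp add: algebra_simps)
      finally show "cmod (u z * v z - poly (p * q) z) < e" using d(3) by linarith
      have "poly (pderiv (p * q)) z = poly p z * poly (pderiv q) z + poly q z * poly (pderiv p) z"
        by (simp add: pderiv_mult)
      also have "cmod \<dots> < (A + 1) * d + (B + 1) * d"
      proof -
        have "cmod (poly p z * poly (pderiv q) z) \<le> (A + 1) * cmod (poly (pderiv q) z)"
          unfolding norm_mult by (intro mult_right_mono pA) simp
        also have "\<dots> < (A + 1) * d"
          using q(2)[OF z] A(1) by simp
        finally have 1: "cmod (poly p z * poly (pderiv q) z) < (A + 1) * d" .
        have "cmod (poly q z * poly (pderiv p) z) \<le> (B + 1) * cmod (poly (pderiv p) z)"
          unfolding norm_mult by (intro mult_right_mono qB) simp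
        also have "\<dots> < (B + 1) * d"
          using p(2)[OF z] B(1) by simp
        finally show ?thesis using 1 norm_add_less by blast
      qed
      also have "\<dots> = d * (A + B + 2)" by (simp add: algebra_simps)
      finally show "cmod (poly (pderiv (p * q)) z) < e" using d(3) by linarith
    qed
    then show "\<exists>p. \<forall>z\<in>X. cmod (u z * v z - poly p z) < e \<and> cmod (poly (pderiv p) z) < e"
      by blast
  qed
qed

text \<open>For the indicator of a clopen set, iterate \<open>3x\<^sup>2 - 2x\<^sup>3\<close>, for which 0 and 1 are superattracting
  fixed points, on a polynomial that is already close to the indicator.\<close>

lemma smoothstep_near_fixed_point:
  fixes x c :: complex
  assumes c: "c = 0 \<or> c = 1" and x: "cmod (x - c) \<le> 1 / 20"
  shows "cmod (3 * x ^ 2 - 2 * x ^ 3 - c) \<le> 1 / 2 * cmod (x - c)" "cmod (6 * x - 6 * x ^ 2) \<le> 1 / 2"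
proof -
  \<comment> \<open>The map commutes with \<open>x -> 1 - x\<close>, which exchanges the two fixed
    points; so both cases reduce to \<open>y\<close> near 0, with \<open>\<sigma>\<close> a
    sign.\<close>
  obtain y \<sigma> :: complex where y: "cmod y \<le> 1 / 20" "cmod y = cmod (x - c)" "cmod \<sigma> = 1"
    "3 * x ^ 2 - 2 * x ^ 3 - c = \<sigma> * (y * y * (3 - 2 * y))" "6 * x - 6 * x ^ 2 = 6 * y * (1 - y)"
  proof (cases "c = 0")
    case True
    show ?thesis
      by (rule that[of x 1]) (use x True in \<open>auto simp: power2_eq_square power3_eq_cube algebra_simps\<close>)
  next
    case False
    then have "c = 1" using c by auto
    show ?thesis
      by (rule that[of "1 - x" "-1"])
        (use x \<open>c = 1\<close> in \<open>auto simp: power2_eq_square power3_eq_cube algebra_simps norm_minus_commute\<close>)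
  qed
  have "cmod (3 - 2 * y) \<le> 4"
    using norm_triangle_ineq4[of 3 "2 * y"] y(1) by (simp add: norm_mult)
  have "cmod (3 * x ^ 2 - 2 * x ^ 3 - c) = cmod y * cmod y * cmod (3 - 2 * y)"
    unfolding y(4) by (simp add: norm_mult y(3))
  also have "\<dots> \<le> cmod y * (1 / 20) * 4"
    by (intro mult_mono y(1) \<open>cmod (3 - 2 * y) \<le> 4\<close>) auto
  also have "\<dots> \<le> 1 / 2 * cmod (x - c)"
    using y(2) by simp
  finally show "cmod (3 * x ^ 2 - 2 * x ^ 3 - c) \<le> 1 / 2 * cmod (x - c)" .
  have "cmod (1 - y) \<le> 3 / 2"
    using norm_triangle_ineq4[of 1 y] y(1) by simp
  have "cmod (6 * x - 6 * x ^ 2) = 6 * cmod y * cmod (1 - y)"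
    unfolding y(5) by (simp add: norm_mult)
  also have "\<dots> \<le> 6 * (1 / 20) * (3 / 2)"
    by (intro mult_mono y(1) \<open>cmod (1 - y) \<le> 3 / 2\<close>) auto
  finally show "cmod (6 * x - 6 * x ^ 2) \<le> 1 / 2" by simp
qed

lemma flat_approx_indicator:
  assumes X: "compact X" "connected (- X)" "interior X = {}"
    and K: "openin (top_of_set X) K" "compact K"
  shows "flat_approx X (indicator K)"
proof -
  have KX: "K \<subseteq> X" using K(1) openin_imp_subset by blast
  have "continuous_on X (indicator K :: complex \<Rightarrow> complex)"
  proof -
    have "closedin (top_of_set X) K" "closedin (top_of_set X) (X - K)"
      using K KX by (auto simp: compact_imp_closed closed_subset intro: openin_closedin_eq[THEN iffD1, THEN conjunct2, of "top_of_set X" K, simplified])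
    then have "continuous_on (K \<union> (X - K)) (\<lambda>z. if z \<in> K then 1 else 0 :: complex)"
      using KX by (intro continuous_on_cases_local) (auto simp: Un_absorb1)
    then show ?thesis
      using KX by (simp add: Un_absorb1 indicator_def of_bool_def)
  qed
  then obtain p where p: "\<And>z. z \<in> X \<Longrightarrow> cmod (indicator K z - poly p z) < 1 / 20"
    using Lavrentiev[OF X] unfolding poly_approx_def by (meson divide_pos_pos zero_less_numeral zero_less_one)
  obtain C where C: "C > 0" "\<And>z. z \<in> X \<Longrightarrow> cmod (poly (pderiv p) z) \<le> C"
    using poly_approx_bounded[OF X(1) poly_approx_poly] by blast
  define q where "q = rec_nat p (\<lambda>_ q. 3 * q ^ 2 - 2 * q ^ 3)"
  have q0: "q 0 = p" and qS: "q (Suc n) = 3 * q n ^ 2 - 2 * q n ^ 3" for n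
    by (simp_all add: q_def)
  \<comment> \<open>Chain rule: each iteration multiplies the derivative by
    \<open>6 * x - 6 * x ^ 2\<close>, of norm at most 1/2 near 0 and 1. The derivative of the first
    polynomial may be large, but its bound \<open>C\<close> is only a factor in front of
    \<open>(1 / 2) ^ n\<close>.\<close>
  have dq: "pderiv (q (Suc n)) = (6 * q n - 6 * q n ^ 2) * pderiv (q n)" for n
    unfolding qS by (simp add: pderiv_diff pderiv_mult power2_eq_square power3_eq_cube algebra_simps pderiv_numeral)
  have inv: "cmod (poly (q n) z - indicator K z) \<le> 1 / 20 * (1 / 2) ^ n \<and>
      cmod (poly (pderiv (q n)) z) \<le> C * (1 / 2) ^ n" if z: "z \<in> X" for n z
  proof (induction n)
    case 0
    then show ?case
      using p[OF z] C(2)[OF z] by (simp add: q0 norm_minus_commute)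
  next
    case (Suc n)
    let ?x = "poly (q n) z" and ?i = "indicator K z :: complex"
    have i: "?i = 0 \<or> ?i = 1" by (simp add: indicator_def)
    have "(1 / 2 :: real) ^ n \<le> 1" by (intro power_le_one) auto
    then have x: "cmod (?x - ?i) \<le> 1 / 20" using Suc by simp
    note s = smoothstep_near_fixed_point[OF i x]
    have "cmod (poly (q (Suc n)) z - ?i) \<le> 1 / 2 * cmod (?x - ?i)"
      unfolding qS using s(1) by simp
    moreover have "cmod (poly (pderiv (q (Suc n))) z) \<le> 1 / 2 * cmod (poly (pderiv (q n)) z)"
      unfolding dq poly_mult norm_mult
      by (intro mult_right_mono) (use s(2) in simp_all)
    ultimately show ?case using Suc by simp
  qed
  show ?thesis
    unfolding flat_approx_def
  proof (intro allI impI)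
    fix e :: real assume "e > 0"
    then have "e / (C + 1) > 0" using C(1) by simp
    then obtain n where n: "(1 / 2 :: real) ^ n < e / (C + 1)"
      using real_arch_pow_inv[of "e / (C + 1)" "1 / 2"] by auto
    then have "(C + 1) * (1 / 2) ^ n < e"
      using C(1) by (simp add: pos_less_divide_eq mult.commute)
    moreover have "0 < (1 / 2 :: real) ^ n" "0 < C * (1 / 2) ^ n" using C(1) by simp_all
    moreover have "(C + 1) * (1 / 2) ^ n = C * (1 / 2) ^ n + (1 / 2) ^ n"
      by (simp add: distrib_right)
    ultimately have "1 / 20 * (1 / 2) ^ n < e" "C * (1 / 2) ^ n < e"
      by linarith+
    then have "cmod (indicator K z - poly (q n) z) < e \<and> cmod (poly (pderiv (q n)) z) < e" if "z \<in> X" for z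
      using inv[OF that, of n] unfolding norm_minus_commute[of "indicator K z"] by linarith
    then show "\<exists>p. \<forall>z\<in>X. cmod (indicator K z - poly p z) < e \<and> cmod (poly (pderiv p) z) < e"
      by blast
  qed
qed

text \<open>A component of \<open>X\<close> is compact but need not be open. By the Sura-Bura
  theorem it has a clopen neighbourhood on which \<open>u\<close> stays within \<open>e\<close> of
  its value at a chosen point; finitely many of these cover \<open>X\<close>, and indicators of
  clopen sets glue the constants together.\<close>

lemma small_oscillation_flat_approx:
  assumes X: "compact X" "connected (- X)" "interior X = {}" and u: "continuous_on X u"
    and "e > 0" and osc: "\<And>z w. connected_component X z w \<Longrightarrow> cmod (u z - u w) < e"
  obtains v where "flat_approx X v" "\<And>z. z \<in> X \<Longrightarrow> cmod (u z - v z) < e"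
proof -
  have "\<exists>K. openin (top_of_set X) K \<and> compact K \<and> x \<in> K \<and> (\<forall>z\<in>K. cmod (u x - u z) < e)" if x: "x \<in> X" for x
  proof -
    define C where "C = connected_component_set X x"
    have C: "C \<in> components X" unfolding C_def using x by (rule componentsI)
    have "openin (top_of_set X) (X \<inter> u -` ball (u x) e)"
      using u by (rule continuous_openin_preimage_gen) simp
    moreover have "C \<subseteq> X \<inter> u -` ball (u x) e"
      using osc connected_component_subset[of X x] by (auto simp: C_def dist_norm)
    moreover have "compact C"
      using compact_components[OF X(1) C] .
    ultimately obtain K where "openin (top_of_set X) K" "compact K" "C \<subseteq> K" "K \<subseteq> X \<inter> u -` ball (u x) e"
      using Sura_Bura_clopen_subset_alt[OF closed_imp_locally_compact[OF compact_imp_closed[OF X(1)]] C] by metis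
    moreover have "x \<in> C" using x by (simp add: C_def)
    ultimately show ?thesis
      by (intro exI[of _ K]) (auto simp: dist_norm)
  qed
  then obtain K where K: "\<And>x. x \<in> X \<Longrightarrow> openin (top_of_set X) (K x)" "\<And>x. x \<in> X \<Longrightarrow> compact (K x)"
    "\<And>x. x \<in> X \<Longrightarrow> x \<in> K x" "\<And>x z. x \<in> X \<Longrightarrow> z \<in> K x \<Longrightarrow> cmod (u x - u z) < e"
    by metis
  obtain Y where Y: "Y \<subseteq> X" "finite Y" "X \<subseteq> (\<Union>x\<in>Y. K x)"
  proof -
    have "\<forall>U\<in>K ` X. openin (top_of_set X) U" "X \<subseteq> \<Union>(K ` X)" using K by auto
    then obtain \<D> where "\<D> \<subseteq> K ` X" "finite \<D>" "X \<subseteq> \<Union>\<D>"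
      using X(1) unfolding compact_eq_openin_cover by metis
    then show ?thesis
      using that finite_subset_image[of \<D> K X] by metis
  qed
  have "\<exists>v. flat_approx X v \<and> (\<forall>z\<in>\<Union>x\<in>Y. K x. cmod (u z - v z) < e)"
    using Y(2,1)
  proof (induction Y rule: finite_induct)
    case empty
    show ?case using flat_approx_const[of X 0] by auto
  next
    case (insert x Y)
    then obtain v where v: "flat_approx X v" "\<forall>z\<in>\<Union>x\<in>Y. K x. cmod (u z - v z) < e" by auto
    have x: "x \<in> X" using insert by simp
    define i :: "complex \<Rightarrow> complex" where "i = indicator (K x)"
    have i: "flat_approx X i"
      unfolding i_def by (intro flat_approx_indicator X K x)
    \<comment> \<open>\<open>w\<close> is \<open>u x\<close> on \<open>K x\<close> and
      \<open>v\<close> elsewhere: later sets overwrite earlier ones, so the cover may overlap. The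
      factor \<open>1 + (- 1) * i\<close> stays within the sums and products already
      treated.\<close>
    define w where "w = (\<lambda>z. i z * u x + (1 + (- 1) * i z) * v z)"
    have "flat_approx X w"
      unfolding w_def by (intro flat_approx_add flat_approx_mult flat_approx_const X i v)
    moreover have "cmod (u z - w z) < e" if "z \<in> (\<Union>x\<in>insert x Y. K x)" for z
    proof (cases "z \<in> K x")
      case True
      then show ?thesis using K(4)[OF x True] by (simp add: w_def i_def norm_minus_commute)
    next
      case False
      then show ?thesis using v(2) that by (auto simp: w_def i_def)
    qed
    ultimately show ?case by blast
  qed
  then show ?thesis using that Y(3) by blast
qed

lemma exists_poly_antiderivative:
  fixes q :: "'a :: field_char_0 poly"
  obtains p where "pderiv p = q"
proof -
  define p where "p = (\<Sum>i\<le>degree q. monom (coeff q i / of_nat (Suc i)) (Suc i))"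
  have sum: "pderiv (sum f A) = (\<Sum>i\<in>A. pderiv (f i))" for f :: "nat \<Rightarrow> 'a poly" and A
    by (induction A rule: infinite_finite_induct) (simp_all add: pderiv_add)
  have "pderiv p = (\<Sum>i\<le>degree q. monom (coeff q i) i)"
    unfolding p_def sum by (intro sum.cong refl) (simp add: pderiv_monom del: of_nat_Suc)
  also have "\<dots> = q" by (rule poly_as_sum_of_monoms)
  finally show ?thesis by (rule that)
qed

section \<open>Density of the polynomials\<close>

theorem theorem5p7:
  fixes X :: "complex set" and F :: "cpath set"
  assumes "perfect_set X" and "compact X"
    and "connected (- X)" and "interior X = {}"
    and "useful X F"
    and "closure (paths_image F) = X"
    and "bdd_above (cpath_length ` F)"
    and "\<And>z w. z \<in> X \<Longrightarrow> w \<in> X \<Longrightarrow> z \<noteq> w \<Longrightarrow> connected_component X z w \<Longrightarrow>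
           \<exists>p\<in>F. joined_by p z w"
  shows "DF_space X F = DF_R X F \<and> DF_R X F = DF_P X F \<and> DF_is_completion_of_D1 X F"
proof -
  note X = assms(2-4) and F = assms(5,6)
  have ne: "X \<noteq> {}" using assms(1) by (simp add: perfect_set_def)
  have approx: "\<exists>p. DF_norm X F (\<lambda>z\<in>X. f z - (\<lambda>z\<in>X. poly p z) z) < e"
    if f: "f \<in> DF_space X F" and "e > 0" for f e
  proof -
    obtain g where g: "F_derivative X F f g"
      using f by (auto simp: DF_space_def)
    have cont: "continuous_on X f" "continuous_on X g"
      using g by (auto simp: F_derivative_def C_space_def)
    obtain L0 where "\<And>p. p \<in> F \<Longrightarrow> cpath_length p \<le> L0"
      using assms(7) by (auto simp: bdd_above_def)
    then obtain L where L: "L > 0" "\<And>p. p \<in> F \<Longrightarrow> cpath_length p \<le> L"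
      by (intro that[of "max 1 L0"]) (auto intro: max.coboundedI2)
    \<comment> \<open>The errors will be \<open>2 * \<eta> * L + \<eta>\<close> for the function and
      \<open>2 * \<eta>\<close> for the derivative, together less than \<open>e\<close>.\<close>
    define \<eta> where "\<eta> = e / (2 * L + 4)"
    have "\<eta> > 0" "\<eta> * (2 * L + 4) = e"
      using L(1) \<open>e > 0\<close> by (simp_all add: \<eta>_def)
    then have \<eta>: "\<eta> > 0" "2 * \<eta> * L + 4 * \<eta> = e"
      by (simp_all add: algebra_simps)
    obtain q where q: "\<And>z. z \<in> X \<Longrightarrow> cmod (g z - poly q z) < \<eta>"
      using Lavrentiev[OF X cont(2)] \<eta>(1) unfolding poly_approx_def by meson
    obtain P where P: "pderiv P = q" by (rule exists_poly_antiderivative)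
    define u where "u = (\<lambda>z. f z - poly P z)"
    \<comment> \<open>Integration along the path gives \<open>\<eta> * L\<close>; doubling it makes
      the inequality strict, as the gluing lemma asks. The orientation of the joining path is
      immaterial, as only a norm is estimated.\<close>
    have osc: "cmod (u z - u w) < 2 * \<eta> * L" if zw: "connected_component X z w" for z w
    proof (cases "z = w")
      case True
      then show ?thesis using \<eta>(1) L(1) by simp
    next
      case False
      have zX: "z \<in> X" "w \<in> X" using zw connected_component_in by blast+
      obtain a b \<gamma> where p: "(a, b, \<gamma>) \<in> F" "{\<gamma> a, \<gamma> b} = {z, w}"
        using assms(8)[OF zX False zw] by (auto simp: joined_by_def)
      note up = useful_path[OF F(1) p(1)]
      have "has_path_integral (\<lambda>z. g z - poly q z) ((f (\<gamma> b) - f (\<gamma> a)) - (poly P (\<gamma> b) - poly P (\<gamma> a))) (a, b, \<gamma>)"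
      proof (intro has_path_integral_diff F_derivative_integral[OF g p(1)])
        show "has_path_integral (poly q) (poly P (\<gamma> b) - poly P (\<gamma> a)) (a, b, \<gamma>)"
          by (rule has_path_integral_derivative[OF up(5) less_imp_le[OF up(1)] up(2,3)])
            (use poly_DERIV[of P] P in \<open>auto intro: has_field_derivative_at_within continuous_intros\<close>)
      qed
      then have "cmod ((f (\<gamma> b) - f (\<gamma> a)) - (poly P (\<gamma> b) - poly P (\<gamma> a))) \<le> \<eta> * variation \<gamma> a b"
        by (rule norm_path_integral_le[OF _ up(5)])
          (use up(1,3) q \<eta>(1) in \<open>auto intro!: less_imp_le[OF q]\<close>)
      also have "\<dots> \<le> \<eta> * L"
        using L(2)[OF p(1)] \<eta>(1) by (simp add: variation_def)
      also have "\<dots> < 2 * \<eta> * L"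
        using \<eta>(1) L(1) by simp
      finally have "cmod (u (\<gamma> b) - u (\<gamma> a)) < 2 * \<eta> * L"
        by (simp add: u_def algebra_simps)
      then show ?thesis
        using p(2) by (auto simp: doubleton_eq_iff norm_minus_commute)
    qed
    have cu: "continuous_on X u"
      unfolding u_def by (intro continuous_intros cont)
    have "2 * \<eta> * L > 0" using \<eta>(1) L(1) by simp
    from small_oscillation_flat_approx[OF X cu this osc]
    obtain v where v: "flat_approx X v" "\<And>z. z \<in> X \<Longrightarrow> cmod (u z - v z) < 2 * \<eta> * L"
      by blast
    obtain r where r: "\<And>z. z \<in> X \<Longrightarrow> cmod (v z - poly r z) < \<eta>" "\<And>z. z \<in> X \<Longrightarrow> cmod (poly (pderiv r) z) < \<eta>"
      using v(1) \<eta>(1) unfolding flat_approx_def by meson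
    \<comment> \<open>\<open>P\<close> takes care of the derivative and \<open>r\<close> of the
      remaining, nearly locally constant part; the derivative of \<open>r\<close> adds at most
      \<open>\<eta>\<close> to the error of \<open>q\<close>.\<close>
    have "DF_norm X F (\<lambda>z\<in>X. f z - (\<lambda>z\<in>X. poly (P + r) z) z) \<le> (2 * \<eta> * L + \<eta>) + 2 * \<eta>"
    proof (rule DF_norm_le[OF F ne g restrict_poly_F_derivative[OF F(1)]])
      fix z assume z: "z \<in> X"
      have "f z - poly (P + r) z = (u z - v z) + (v z - poly r z)"
        by (simp add: u_def)
      also have "cmod \<dots> < 2 * \<eta> * L + \<eta>"
        by (rule norm_add_less[OF v(2)[OF z] r(1)[OF z]])
      finally show "cmod (f z - (\<lambda>z\<in>X. poly (P + r) z) z) \<le> 2 * \<eta> * L + \<eta>"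
        using z by simp
      have "g z - poly (pderiv (P + r)) z = (g z - poly q z) - poly (pderiv r) z"
        by (simp add: pderiv_add P)
      also have "cmod \<dots> \<le> \<eta> + \<eta>"
        by (intro order_trans[OF norm_triangle_ineq4] add_mono less_imp_le[OF q[OF z]] less_imp_le[OF r(2)[OF z]])
      finally show "cmod (g z - (\<lambda>z\<in>X. poly (pderiv (P + r)) z) z) \<le> 2 * \<eta>"
        using z by simp
    qed
    also have "\<dots> < e" using \<eta> by simp
    finally show ?thesis by blast
  qed
  \<comment> \<open>All three density claims are instances: each of the three sets of functions
    contains the polynomials.\<close>
  have dense: "DF_closure X F S = DF_space X F" if S: "\<And>p. (\<lambda>z\<in>X. poly p z) \<in> S" for S
  proof -
    have poly: "(\<lambda>z\<in>X. poly p z) \<in> S \<inter> DF_space X F" for p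
      using S F_derivative_in_DF_space[OF restrict_poly_F_derivative[OF F(1)]] by blast
    have "\<exists>h\<in>S \<inter> DF_space X F. DF_norm X F (\<lambda>z\<in>X. f z - h z) < e" if fe: "f \<in> DF_space X F" "e > 0" for f e
    proof -
      obtain p where "DF_norm X F (\<lambda>z\<in>X. f z - (\<lambda>z\<in>X. poly p z) z) < e"
        using approx[OF fe] ..
      then show ?thesis by (rule bexI[OF _ poly])
    qed
    then show ?thesis unfolding DF_closure_def by auto
  qed
  have "(\<lambda>z\<in>X. poly p z) \<in> rational_functions X" for p
    unfolding rational_functions_def by (rule CollectI, rule exI[of _ p], rule exI[of _ 1]) simp
  then have R: "DF_R X F = DF_space X F"
    unfolding DF_R_def by (rule dense)
  have "(\<lambda>z\<in>X. poly p z) \<in> polynomial_functions X" for p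
    unfolding polynomial_functions_def by blast
  then have P: "DF_P X F = DF_space X F"
    unfolding DF_P_def by (rule dense)
  have "(\<lambda>z\<in>X. poly p z) \<in> D1_space X" for p
    unfolding D1_space_def
  proof (intro CollectI conjI bexI[OF _ restrict_poly_in_C_space] ballI)
    show "((\<lambda>z\<in>X. poly p z) has_field_derivative (\<lambda>z\<in>X. poly (pderiv p) z) z) (at z within X)"
      if "z \<in> X" for z using that by (rule restrict_poly_derivative)
  qed simp
  then have "DF_closure X F (D1_space X) = DF_space X F"
    by (rule dense)
  moreover have "D1_space X \<subseteq> DF_space X F"
  proof
    fix f assume "f \<in> D1_space X"
    then obtain f' where "F_derivative X F f f'"
      using D1_F_derivative[OF F(1)] unfolding D1_space_def by blast
    then show "f \<in> DF_space X F"
      by (rule F_derivative_in_DF_space)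
  qed
  ultimately show ?thesis
    by (simp add: R P DF_is_completion_of_D1_def)
qed

end
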